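(* Let $G$ be a finite group, let $T_\varphi$ be an admissible operator on $L^2(G)$, and let $(\alpha_K)_{K\in\mathcal{K}}$ be real numbers with $\omega_{T_\varphi}=\sum_{K\in\mathcal{K}}\alpha_K\omega_K$. If $\alpha_K\ge0$ for every $K\in\mathcal{K}$, then $T_{\varphi^\natural}$ is positive semidefinite and is the Laplacian of the weighted Cayley graph on $G$ carrying weight $\alpha_K/|K|$ on the edges labeled by $K$.
   Context: $L^2(G)$ is the space of functions $f:G\to\mathbb{C}$ with inner product $\langle f,h\rangle=\frac{1}{|G|}\sum_{g\in G}\overline{f(g)}h(g)$. A linear operator $T$ on $L^2(G)$ is admissible if it is Hermitian, commutes with all left translations $(L_af)(g)=f(a^{-1}g)$, annihilates the constant functions, and satisfies $\langle\overline{f},T\overline{f}\rangle=\langle f,Tf\rangle$ for every $f$. For $\varphi\in L^2(G)$, $(T_\varphi f)(g)=\sum_{h\in G}\varphi(g^{-1}h)f(h)$; every admissible operator has this form. The conjugation average is $\varphi^\natural(x)=\frac{1}{|G|}\sum_{a\in G}\varphi(axa^{-1})$. $\widehat{G}$ is the set of equivalence classes of irreducible complex representations, each represented by a unitary matrix representation $\sigma$ of dimension $d_\sigma$ with entries $\sigma_{ij}$; $\mathcal{A}_\sigma=\operatorname{span}\{\sigma_{ij}\}\subseteq L^2(G)$, which every admissible operator preserves; $\omega_T(\sigma)$ is the mean of the eigenvalues (with multiplicity) of the admissible operator $T$ on $\mathcal{A}_\sigma$. $\mathcal{K}$ is the collection of sets $C\cup C^{-1}$ with $C$ a conjugacy class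 of $G$ other than $\{e\}$; $(A_Kf)(g)=\frac{1}{|K|}\sum_{s\in K}f(gs)$, $\mathcal{L}_K=I-A_K$, $\omega_K=\omega_{\mathcal{L}_K}$. The weighted Cayley graph has vertex set $G$ and, for each $K\in\mathcal{K}$, $s\in K$, $g\in G$, weight $\alpha_K/|K|$ on the edge joining $g$ and $gs$; its Laplacian is $f\mapsto\left(g\mapsto\sum_{K\in\mathcal{K}}\frac{\alpha_K}{|K|}\sum_{s\in K}(f(g)-f(gs))\right)$. *)

theory Defs
  imports
    Complex_Main
    "HOL-Library.Function_Algebras"
    "HOL-Algebra.Group_Action"
    "Jordan_Normal_Form.VS_Connect"
    "Jordan_Normal_Form.Schur_Decomposition"
    "Graph_Theory.Digraph"
begin

section \<open>The space of functions on a finite group\<close>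

text \<open>Functions on the group are total functions vanishing off the carrier, so that
  \<open>L2 G\<close> is a subspace of the space of all functions with its pointwise operations.\<close>

definition L2 :: "('a, 'b) monoid_scheme \<Rightarrow> ('a \<Rightarrow> complex) set" where
  "L2 G = {f. \<forall>x. x \<notin> carrier G \<longrightarrow> f x = 0}"

definition on_carrier :: "('a, 'b) monoid_scheme \<Rightarrow> ('a \<Rightarrow> complex) \<Rightarrow> 'a \<Rightarrow> complex" where
  "on_carrier G f = (\<lambda>x. if x \<in> carrier G then f x else 0)"

definition cscale :: "complex \<Rightarrow> ('a \<Rightarrow> complex) \<Rightarrow> 'a \<Rightarrow> complex" where
  "cscale c f = (\<lambda>x. c * f x)"

global_interpretation cfun: vector_space "cscale :: complex \<Rightarrow> ('a \<Rightarrow> complex) \<Rightarrow> 'a \<Rightarrow> complex"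
  by unfold_locales (simp_all add: cscale_def fun_eq_iff algebra_simps)

definition inner_L2 ::
    "('a, 'b) monoid_scheme \<Rightarrow> ('a \<Rightarrow> complex) \<Rightarrow> ('a \<Rightarrow> complex) \<Rightarrow> complex" where
  "inner_L2 G f h = (1 / of_nat (card (carrier G))) * (\<Sum>g\<in>carrier G. cnj (f g) * h g)"

type_synonym 'a operator = "('a \<Rightarrow> complex) \<Rightarrow> 'a \<Rightarrow> complex"

definition linear_operator :: "('a, 'b) monoid_scheme \<Rightarrow> 'a operator \<Rightarrow> bool" where
  "linear_operator G T \<longleftrightarrow>
     (\<forall>f\<in>L2 G. T f \<in> L2 G) \<and>
     (\<forall>f\<in>L2 G. \<forall>h\<in>L2 G. T (f + h) = T f + T h) \<and>
     (\<forall>c. \<forall>f\<in>L2 G. T (cscale c f) = cscale c (T f))"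

definition hermitian_operator :: "('a, 'b) monoid_scheme \<Rightarrow> 'a operator \<Rightarrow> bool" where
  "hermitian_operator G T \<longleftrightarrow> linear_operator G T \<and>
     (\<forall>f\<in>L2 G. \<forall>h\<in>L2 G. inner_L2 G f (T h) = inner_L2 G (T f) h)"

text \<open>For a Hermitian operator the number \<open>inner_L2 G f (T f)\<close> is real.\<close>

definition positive_semidefinite :: "('a, 'b) monoid_scheme \<Rightarrow> 'a operator \<Rightarrow> bool" where
  "positive_semidefinite G T \<longleftrightarrow> hermitian_operator G T \<and>
     (\<forall>f\<in>L2 G. 0 \<le> Re (inner_L2 G f (T f)))"

definition left_translation :: "('a, 'b) monoid_scheme \<Rightarrow> 'a \<Rightarrow> 'a operator" where
  "left_translation G a f = on_carrier G (\<lambda>g. f (inv\<^bsub>G\<^esub> a \<otimes>\<^bsub>G\<^esub> g))"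

definition admissible :: "('a, 'b) monoid_scheme \<Rightarrow> 'a operator \<Rightarrow> bool" where
  "admissible G T \<longleftrightarrow> hermitian_operator G T \<and>
     (\<forall>a\<in>carrier G. \<forall>f\<in>L2 G. T (left_translation G a f) = left_translation G a (T f)) \<and>
     (\<forall>c. T (on_carrier G (\<lambda>_. c)) = 0) \<and>
     (\<forall>f\<in>L2 G. inner_L2 G (\<lambda>g. cnj (f g)) (T (\<lambda>g. cnj (f g))) = inner_L2 G f (T f))"

definition conv_operator :: "('a, 'b) monoid_scheme \<Rightarrow> ('a \<Rightarrow> complex) \<Rightarrow> 'a operator" where
  "conv_operator G \<phi> f =
     on_carrier G (\<lambda>g. \<Sum>h\<in>carrier G. \<phi> (inv\<^bsub>G\<^esub> g \<otimes>\<^bsub>G\<^esub> h) * f h)"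

definition conj_average ::
    "('a, 'b) monoid_scheme \<Rightarrow> ('a \<Rightarrow> complex) \<Rightarrow> 'a \<Rightarrow> complex" where
  "conj_average G \<phi> = on_carrier G (\<lambda>x. (1 / of_nat (card (carrier G))) *
     (\<Sum>a\<in>carrier G. \<phi> (a \<otimes>\<^bsub>G\<^esub> x \<otimes>\<^bsub>G\<^esub> inv\<^bsub>G\<^esub> a)))"


section \<open>Irreducible representations and the dual\<close>

definition rep_dim :: "('a, 'b) monoid_scheme \<Rightarrow> ('a \<Rightarrow> complex mat) \<Rightarrow> nat" where
  "rep_dim G \<sigma> = dim_row (\<sigma> \<one>\<^bsub>G\<^esub>)"

definition matrix_rep :: "('a, 'b) monoid_scheme \<Rightarrow> ('a \<Rightarrow> complex mat) \<Rightarrow> bool" where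
  "matrix_rep G \<sigma> \<longleftrightarrow>
     (\<forall>g\<in>carrier G. \<sigma> g \<in> carrier_mat (rep_dim G \<sigma>) (rep_dim G \<sigma>)) \<and>
     \<sigma> \<one>\<^bsub>G\<^esub> = 1\<^sub>m (rep_dim G \<sigma>) \<and>
     (\<forall>g\<in>carrier G. \<forall>h\<in>carrier G. \<sigma> (g \<otimes>\<^bsub>G\<^esub> h) = \<sigma> g * \<sigma> h)"

definition unitary_rep :: "('a, 'b) monoid_scheme \<Rightarrow> ('a \<Rightarrow> complex mat) \<Rightarrow> bool" where
  "unitary_rep G \<sigma> \<longleftrightarrow> matrix_rep G \<sigma> \<and>
     (\<forall>g\<in>carrier G. mat_adjoint (\<sigma> g) * \<sigma> g = 1\<^sub>m (rep_dim G \<sigma>))"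

definition irreducible_rep :: "('a, 'b) monoid_scheme \<Rightarrow> ('a \<Rightarrow> complex mat) \<Rightarrow> bool" where
  "irreducible_rep G \<sigma> \<longleftrightarrow> matrix_rep G \<sigma> \<and> 0 < rep_dim G \<sigma> \<and>
     (\<forall>W. VectorSpace.subspace class_ring W (module_vec TYPE(complex) (rep_dim G \<sigma>)) \<and>
          (\<forall>g\<in>carrier G. \<forall>w\<in>W. \<sigma> g *\<^sub>v w \<in> W) \<longrightarrow>
          W = {0\<^sub>v (rep_dim G \<sigma>)} \<or> W = carrier_vec (rep_dim G \<sigma>))"

definition rep_equiv ::
    "('a, 'b) monoid_scheme \<Rightarrow> (('a \<Rightarrow> complex mat) \<times> ('a \<Rightarrow> complex mat)) set" where
  "rep_equiv G = {(\<sigma>, \<tau>). irreducible_rep G \<sigma> \<and> irreducible_rep G \<tau> \<and>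
     rep_dim G \<sigma> = rep_dim G \<tau> \<and>
     (\<exists>P\<in>carrier_mat (rep_dim G \<sigma>) (rep_dim G \<sigma>). invertible_mat P \<and>
        (\<forall>g\<in>carrier G. P * \<sigma> g = \<tau> g * P))}"

definition dual :: "('a, 'b) monoid_scheme \<Rightarrow> ('a \<Rightarrow> complex mat) set set" where
  "dual G = {\<sigma>. irreducible_rep G \<sigma>} // rep_equiv G"

text \<open>A chosen unitary representative of an equivalence class. Since \<open>G\<close> is finite, every class
  contains a unitary representation; the spans of matrix coefficients below do not depend on
  the choice.\<close>

definition unitary_representative ::
    "('a, 'b) monoid_scheme \<Rightarrow> ('a \<Rightarrow> complex mat) set \<Rightarrow> 'a \<Rightarrow> complex mat" where
  "unitary_representative G c = (SOME \<sigma>. \<sigma> \<in> c \<and> unitary_rep G \<sigma>)"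

definition matrix_coeff_space ::
    "('a, 'b) monoid_scheme \<Rightarrow> ('a \<Rightarrow> complex mat) \<Rightarrow> ('a \<Rightarrow> complex) set" where
  "matrix_coeff_space G \<sigma> = cfun.span
     {on_carrier G (\<lambda>g. \<sigma> g $$ (i, j)) | i j. i < rep_dim G \<sigma> \<and> j < rep_dim G \<sigma>}"

definition eigenvalues_on :: "'a operator \<Rightarrow> ('a \<Rightarrow> complex) set \<Rightarrow> complex set" where
  "eigenvalues_on T A = {l. \<exists>f\<in>A. f \<noteq> 0 \<and> T f = cscale l f}"

definition eigenspace_on ::
    "'a operator \<Rightarrow> ('a \<Rightarrow> complex) set \<Rightarrow> complex \<Rightarrow> ('a \<Rightarrow> complex) set" where
  "eigenspace_on T A l = {f\<in>A. T f = cscale l f}"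

text \<open>The multiplicity of an eigenvalue is the dimension of its eigenspace. The operators
  considered are Hermitian, for which geometric and algebraic multiplicities coincide.\<close>

definition eigenvalue_mean :: "'a operator \<Rightarrow> ('a \<Rightarrow> complex) set \<Rightarrow> complex" where
  "eigenvalue_mean T A =
     (\<Sum>l\<in>eigenvalues_on T A. of_nat (cfun.dim (eigenspace_on T A l)) * l) /
     (\<Sum>l\<in>eigenvalues_on T A. of_nat (cfun.dim (eigenspace_on T A l)))"

definition omega ::
    "('a, 'b) monoid_scheme \<Rightarrow> 'a operator \<Rightarrow> ('a \<Rightarrow> complex mat) set \<Rightarrow> complex" where
  "omega G T c = eigenvalue_mean T (matrix_coeff_space G (unitary_representative G c))"


section \<open>Symmetrized conjugacy classes and weighted Cayley graphs\<close>

definition conjugacy_classes :: "('a, 'b) monoid_scheme \<Rightarrow> 'a set set" where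
  "conjugacy_classes G = orbits G (carrier G) (\<lambda>a x. a \<otimes>\<^bsub>G\<^esub> x \<otimes>\<^bsub>G\<^esub> inv\<^bsub>G\<^esub> a)"

definition sym_classes :: "('a, 'b) monoid_scheme \<Rightarrow> 'a set set" where
  "sym_classes G = {C \<union> set_inv\<^bsub>G\<^esub> C | C. C \<in> conjugacy_classes G \<and> C \<noteq> {\<one>\<^bsub>G\<^esub>}}"

definition class_average :: "('a, 'b) monoid_scheme \<Rightarrow> 'a set \<Rightarrow> 'a operator" where
  "class_average G K f = on_carrier G (\<lambda>g. (1 / of_nat (card K)) * (\<Sum>s\<in>K. f (g \<otimes>\<^bsub>G\<^esub> s)))"

definition class_laplacian :: "('a, 'b) monoid_scheme \<Rightarrow> 'a set \<Rightarrow> 'a operator" where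
  "class_laplacian G K f = f - class_average G K f"

text \<open>The arc \<open>(g, K, s)\<close> runs from \<open>g\<close> to \<open>gs\<close> and is labelled by \<open>K\<close>. As every \<open>K\<close> is closed
  under inversion, reversal sends it to the arc \<open>(gs, K, s\<inverse>)\<close> of the same weight, so the
  digraph encodes an undirected graph.\<close>

definition cayley_graph ::
    "('a, 'b) monoid_scheme \<Rightarrow> ('a, 'a \<times> 'a set \<times> 'a) pre_digraph" where
  "cayley_graph G = \<lparr>verts = carrier G,
     arcs = {(g, K, s). g \<in> carrier G \<and> K \<in> sym_classes G \<and> s \<in> K},
     tail = (\<lambda>(g, K, s). g),
     head = (\<lambda>(g, K, s). g \<otimes>\<^bsub>G\<^esub> s)\<rparr>"

definition cayley_weight :: "('a set \<Rightarrow> real) \<Rightarrow> 'a \<times> 'a set \<times> 'a \<Rightarrow> real" where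
  "cayley_weight \<alpha> = (\<lambda>(g, K, s). \<alpha> K / real (card K))"

definition graph_laplacian ::
    "('v, 'e) pre_digraph \<Rightarrow> ('e \<Rightarrow> real) \<Rightarrow> ('v \<Rightarrow> complex) \<Rightarrow> 'v \<Rightarrow> complex" where
  "graph_laplacian D w f = (\<lambda>v. if v \<in> verts D
     then (\<Sum>a\<in>out_arcs D v. of_real (w a) * (f v - f (head D a))) else 0)"

lemma cayley_laplacian_formula:
  fixes G (structure)
  assumes "group G" "finite (carrier G)" and g: "g \<in> carrier G"
  shows "graph_laplacian (cayley_graph G) (cayley_weight \<alpha>) f g =
    (\<Sum>K\<in>sym_classes G. of_real (\<alpha> K / real (card K)) * (\<Sum>s\<in>K. f g - f (g \<otimes> s)))"
proof -
  interpret group G by fact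
  have sub: "K \<subseteq> carrier G" if "K \<in> sym_classes G" for K
    using that by (auto simp: sym_classes_def conjugacy_classes_def orbits_def orbit_def SET_INV_def)
  have fin: "finite (sym_classes G)" "\<And>K. K \<in> sym_classes G \<Longrightarrow> finite K"
    using assms(2) sub by (auto intro: finite_subset[of _ "Pow (carrier G)"] finite_subset)
  have "out_arcs (cayley_graph G) g = Pair g ` Sigma (sym_classes G) (\<lambda>K. K)"
    using g by (auto simp: out_arcs_def cayley_graph_def)
  then have "graph_laplacian (cayley_graph G) (cayley_weight \<alpha>) f g =
      (\<Sum>(K, s)\<in>Sigma (sym_classes G) (\<lambda>K. K). of_real (\<alpha> K / real (card K)) * (f g - f (g \<otimes> s)))"
    using g by (simp add: graph_laplacian_def sum.reindex inj_on_def cayley_graph_def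
        cayley_weight_def case_prod_unfold)
  also have "\<dots> = (\<Sum>K\<in>sym_classes G. \<Sum>s\<in>K. of_real (\<alpha> K / real (card K)) * (f g - f (g \<otimes> s)))"
    using fin by (subst sum.Sigma) auto
  finally show ?thesis
    by (simp add: sum_distrib_left)
qed

end

theory Submission
  imports Defs "Jordan_Normal_Form.Spectral_Radius"
begin

text \<open>
  A Hermitian operator preserving \<open>\<A>\<^sub>\<sigma>\<close> has eigenvalue mean \<open>trace / dim\<close> there, which is linear in the
  operator and, on convolution operators, unchanged by averaging the kernel over conjugation, because
  \<open>\<A>\<^sub>\<sigma>\<close> is invariant under right translations. Hence the hypothesis on \<open>\<omega>\<close> says that the convolution
  operator \<open>D\<close> with kernel \<open>\<phi>\<^sup>\<natural> - \<kappa>\<close>, where \<open>\<kappa>\<close> is the kernel of the Laplacian, has trace \<open>0\<close> on every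
  \<open>\<A>\<^sub>\<sigma>\<close>. The kernel of \<open>D\<close> is a class function, so \<open>D\<close> commutes with right translations. If the
  Hermitian operator \<open>D\<close> had a nonzero eigenvalue \<open>l\<close>, a minimal right-invariant subspace of its eigenspace
  would carry an irreducible unitary representation \<open>\<sigma>\<close> with \<open>\<Sum>x. \<delta> x \<sigma> x = l I\<close>, so \<open>D\<close> would act as \<open>l\<close> on
  \<open>\<A>\<^sub>\<sigma>\<close>, contradicting the vanishing trace. Thus \<open>D = 0\<close>. This needs neither Schur orthogonality nor the
  Peter--Weyl decomposition.
\<close>

section \<open>Preliminary notions: orthonormal sets, traces, right translations\<close>

lemma sum_fun_apply: "(\<Sum>i\<in>I. F i) x = (\<Sum>i\<in>I. F i x)"
  for F :: "'i \<Rightarrow> 'x \<Rightarrow> 'c::comm_monoid_add"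
  by (induction I rule: infinite_finite_induct) auto

definition orthonormal :: "('a, 'b) monoid_scheme \<Rightarrow> ('a \<Rightarrow> complex) set \<Rightarrow> bool" where
  "orthonormal G B \<longleftrightarrow> finite B \<and> B \<subseteq> L2 G \<and>
     (\<forall>e\<in>B. \<forall>f\<in>B. inner_L2 G e f = (if e = f then 1 else 0))"

text \<open>For orthonormal \<open>B\<close>, the trace of the compression of \<open>T\<close> to
  \<open>span B\<close>; it is the trace of the restriction once \<open>span B\<close> is
  \<open>T\<close>-invariant.\<close>

definition operator_trace ::
    "('a, 'b) monoid_scheme \<Rightarrow> ('a \<Rightarrow> complex) set \<Rightarrow> 'a operator \<Rightarrow> complex" where
  "operator_trace G B T = (\<Sum>e\<in>B. inner_L2 G e (T e))"

text \<open>The right regular representation; convolution operators are its linear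
  combinations.\<close>

definition right_translation :: "('a, 'b) monoid_scheme \<Rightarrow> 'a \<Rightarrow> 'a operator" where
  "right_translation G x f = on_carrier G (\<lambda>g. f (g \<otimes>\<^bsub>G\<^esub> x))"

locale finite_group = group G for G (structure) +
  assumes finite_carrier: "finite (carrier G)"
begin

section \<open>Orthonormal bases of subspaces of \<open>L2 G\<close>\<close>

lemma L2_subspace: "cfun.subspace (L2 G)"
  by (auto simp: cfun.subspace_def L2_def cscale_def)

lemma L2_diff: "f \<in> L2 G \<Longrightarrow> h \<in> L2 G \<Longrightarrow> f - h \<in> L2 G"
  and L2_scale: "f \<in> L2 G \<Longrightarrow> cscale c f \<in> L2 G"
  and L2_sum: "(\<And>i. i \<in> I \<Longrightarrow> F i \<in> L2 G) \<Longrightarrow> (\<Sum>i\<in>I. F i) \<in> L2 G"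
  using cfun.subspace_diff[OF L2_subspace]
    cfun.subspace_scale[OF L2_subspace] cfun.subspace_sum[OF L2_subspace] by blast+

lemma on_carrier_L2: "on_carrier G f \<in> L2 G"
  by (simp add: on_carrier_def L2_def)

lemma L2_eqI: "f \<in> L2 G \<Longrightarrow> h \<in> L2 G \<Longrightarrow> (\<And>g. g \<in> carrier G \<Longrightarrow> f g = h g) \<Longrightarrow> f = h"
  unfolding L2_def mem_Collect_eq by (metis ext)

lemma card_carrier_pos: "0 < card (carrier G)"
  using finite_carrier one_closed by (auto simp: card_gt_0_iff)

lemma inner_add_right: "inner_L2 G f (h + k) = inner_L2 G f h + inner_L2 G f k"
  and inner_add_left: "inner_L2 G (h + k) f = inner_L2 G h f + inner_L2 G k f"
  and inner_diff_right: "inner_L2 G f (h - k) = inner_L2 G f h - inner_L2 G f k"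
  and inner_diff_left: "inner_L2 G (h - k) f = inner_L2 G h f - inner_L2 G k f"
  by (simp_all add: inner_L2_def algebra_simps sum.distrib sum_subtractf)

lemma inner_scale_right: "inner_L2 G f (cscale c h) = c * inner_L2 G f h"
  and inner_scale_left: "inner_L2 G (cscale c f) h = cnj c * inner_L2 G f h"
  by (simp_all add: inner_L2_def cscale_def sum_distrib_left algebra_simps)

lemma inner_zero_right [simp]: "inner_L2 G f 0 = 0"
  and inner_zero_left [simp]: "inner_L2 G 0 f = 0"
  by (simp_all add: inner_L2_def)

lemma inner_sum_right: "inner_L2 G f (\<Sum>i\<in>I. F i) = (\<Sum>i\<in>I. inner_L2 G f (F i))"
  by (induction I rule: infinite_finite_induct) (simp_all add: inner_add_right del: plus_fun_apply zero_fun_apply)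

lemma inner_sum_left: "inner_L2 G (\<Sum>i\<in>I. F i) f = (\<Sum>i\<in>I. inner_L2 G (F i) f)"
  by (induction I rule: infinite_finite_induct) (simp_all add: inner_add_left del: plus_fun_apply zero_fun_apply)

lemma cnj_inner: "cnj (inner_L2 G f h) = inner_L2 G h f"
  by (simp add: inner_L2_def mult.commute)

lemma inner_self:
  "inner_L2 G f f = of_real ((\<Sum>g\<in>carrier G. (cmod (f g))\<^sup>2) / card (carrier G))"
  unfolding inner_L2_def of_real_divide of_real_sum complex_norm_square by (simp add: mult.commute)

lemma inner_self_nonneg: "0 \<le> Re (inner_L2 G f f)"
  by (simp add: inner_self sum_nonneg)

lemma inner_self_eq_0: "f \<in> L2 G \<Longrightarrow> inner_L2 G f f = 0 \<Longrightarrow> f = 0"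
  using card_carrier_pos
  by (auto simp: inner_self sum_nonneg_eq_0_iff finite_carrier L2_def fun_eq_iff
      simp del: of_real_divide of_real_sum)

lemma normalize:
  assumes "f \<in> L2 G" "f \<noteq> 0"
  shows "\<exists>c. inner_L2 G (cscale c f) (cscale c f) = 1"
proof -
  define r where "r = (\<Sum>g\<in>carrier G. (cmod (f g))\<^sup>2) / card (carrier G)"
  have r: "inner_L2 G f f = of_real r" "r \<ge> 0"
    unfolding r_def by (auto simp: inner_self sum_nonneg simp del: of_real_divide of_real_sum)
  then have "r > 0" using inner_self_eq_0[OF assms(1)] assms(2) by (cases "r = 0") auto
  then have "inner_L2 G (cscale (1 / sqrt r) f) (cscale (1 / sqrt r) f) = 1"
    by (simp add: inner_scale_left inner_scale_right r(1) flip: of_real_mult)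
  then show ?thesis by blast
qed

text \<open>The map \<open>p\<close> is linear and fixes each element of \<open>B\<close>, so its
  fixed points form a subspace containing \<open>span B\<close>.\<close>

lemma orthonormal_expansion:
  assumes "orthonormal G B" "f \<in> cfun.span B"
  shows "f = (\<Sum>e\<in>B. cscale (inner_L2 G e f) e)"
proof -
  define p where "p f = (\<Sum>e\<in>B. cscale (inner_L2 G e f) e)" for f
  have base: "p b = b" if b: "b \<in> B" for b
  proof -
    have "p b = (\<Sum>e\<in>B. if e = b then b else 0)"
      unfolding p_def using assms(1) b by (intro sum.cong refl) (auto simp: orthonormal_def)
    then show ?thesis using assms(1) b by (simp add: orthonormal_def)
  qed
  have "p (f + h) = p f + p h" "p (cscale c f) = cscale c (p f)" "p 0 = 0" for c f h
    by (simp_all add: p_def inner_add_right inner_scale_right cfun.scale_left_distrib sum.distrib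
        cfun.scale_sum_right)
  then have "cfun.subspace {f. p f = f}" by (simp add: cfun.subspace_def)
  then have "cfun.span B \<subseteq> {f. p f = f}" using base by (intro cfun.span_minimal) auto
  then show ?thesis using assms(2) by (auto simp: p_def)
qed

lemma orthonormal_inner_sum:
  assumes "orthonormal G B" "S \<subseteq> B" "b \<in> S"
  shows "inner_L2 G b (\<Sum>e\<in>S. cscale (u e) e) = u b"
proof -
  have "finite S" using assms by (auto simp: orthonormal_def intro: finite_subset)
  have "inner_L2 G b (\<Sum>e\<in>S. cscale (u e) e) = (\<Sum>e\<in>S. if e = b then u b else 0)"
    unfolding inner_sum_right inner_scale_right
    using assms subsetD[OF assms(2)] by (intro sum.cong refl) (auto simp: orthonormal_def)
  then show ?thesis using \<open>finite S\<close> assms(3) by simp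
qed

lemma orthonormal_independent:
  assumes "orthonormal G B"
  shows "cfun.independent B"
proof -
  have "u b = 0" if "S \<subseteq> B" "(\<Sum>e\<in>S. cscale (u e) e) = 0" "b \<in> S" for S u b
    using orthonormal_inner_sum[OF assms that(1,3), of u] that(2) by simp
  then show ?thesis unfolding cfun.independent_explicit_finite_subsets by blast
qed

lemma orthonormal_mono: "orthonormal G B \<Longrightarrow> S \<subseteq> B \<Longrightarrow> orthonormal G S"
  unfolding orthonormal_def by (meson finite_subset subset_iff)

text \<open>Bounds orthonormal sets so that maximal ones exist: the point masses \<open>d x\<close>
  span \<open>L2 G\<close>, and an independent set is no larger than a finite spanning set.\<close>

lemma orthonormal_card_le:
  assumes "orthonormal G B"
  shows "card B \<le> card (carrier G)"
proof -
  define d where "d x = (\<lambda>g. if g = x then 1 else 0 :: complex)" for x :: 'a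
  have "f \<in> cfun.span (d ` carrier G)" if "f \<in> L2 G" for f
  proof -
    have "f = (\<Sum>x\<in>carrier G. cscale (f x) (d x))"
      using that by (auto simp: fun_eq_iff sum_fun_apply cscale_def d_def L2_def if_distrib finite_carrier
          cong: if_cong)
    also have "\<dots> \<in> cfun.span (d ` carrier G)"
      by (intro cfun.span_sum cfun.span_scale cfun.span_base imageI)
    finally show ?thesis .
  qed
  then have "B \<subseteq> cfun.span (d ` carrier G)" using assms by (auto simp: orthonormal_def)
  from cfun.independent_span_bound[OF _ orthonormal_independent[OF assms] this]
  have "card B \<le> card (d ` carrier G)" using finite_carrier by auto
  also have "\<dots> \<le> card (carrier G)" by (rule card_image_le[OF finite_carrier])
  finally show ?thesis .
qed

lemma orthonormal_insert:
  assumes "orthonormal G B" "e \<in> L2 G" "inner_L2 G e e = 1" "\<forall>b\<in>B. inner_L2 G b e = 0"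
  shows "orthonormal G (insert e B)" "e \<notin> B"
proof -
  have "\<forall>b\<in>B. inner_L2 G e b = 0" using assms(4) cnj_inner by (metis complex_cnj_zero)
  then show "orthonormal G (insert e B)" "e \<notin> B"
    using assms by (auto simp: orthonormal_def)
qed

text \<open>A largest orthonormal subset of \<open>A\<close> with all elements satisfying
  \<open>P\<close> must span \<open>A\<close>, since \<open>step\<close> would enlarge it otherwise.
  The parameter \<open>P\<close> serves two uses: trivial for plain bases, being an eigenvector for
  the spectral theorem.\<close>

lemma orthonormal_basis_extension:
  assumes A: "A \<subseteq> L2 G" "cfun.subspace A"
    and step: "\<And>B. orthonormal G B \<Longrightarrow> B \<subseteq> A \<Longrightarrow> \<forall>e\<in>B. P e \<Longrightarrow> cfun.span B \<noteq> A \<Longrightarrow>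
      \<exists>e\<in>A. P e \<and> inner_L2 G e e = 1 \<and> (\<forall>b\<in>B. inner_L2 G b e = 0)"
  shows "\<exists>B. orthonormal G B \<and> cfun.span B = A \<and> (\<forall>e\<in>B. P e)"
proof -
  let ?Q = "\<lambda>B. orthonormal G B \<and> B \<subseteq> A \<and> (\<forall>e\<in>B. P e)"
  have "?Q {}" by (simp add: orthonormal_def)
  \<comment> \<open>\<open>Suc\<close> makes the bound strict, as the existence of a maximum of
    \<open>card\<close> requires.\<close>
  moreover have "\<forall>B. ?Q B \<longrightarrow> card B < Suc (card (carrier G))"
    using orthonormal_card_le by (simp add: less_Suc_eq_le)
  ultimately obtain B where B: "?Q B" and max: "\<And>B'. ?Q B' \<Longrightarrow> card B' \<le> card B"
    using ex_has_greatest_nat[of ?Q "{}" card "Suc (card (carrier G))"]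
    by blast
  have "cfun.span B = A"
  proof (rule ccontr)
    assume "cfun.span B \<noteq> A"
    then obtain e where e: "e \<in> A" "P e" "inner_L2 G e e = 1" "\<forall>b\<in>B. inner_L2 G b e = 0"
      using step B by blast
    have "orthonormal G (insert e B)" "e \<notin> B" using orthonormal_insert[of B e] B e A by auto
    moreover have "finite B" using B by (simp add: orthonormal_def)
    ultimately show False using max[of "insert e B"] B e by simp
  qed
  then show ?thesis using B by blast
qed

text \<open>One Gram-Schmidt step: subtract from a vector of \<open>A\<close> outside the span its
  projection \<open>?p\<close>, then normalize.\<close>

lemma orthogonal_unit_vector_exists:
  assumes A: "A \<subseteq> L2 G" "cfun.subspace A" and B: "orthonormal G B" "B \<subseteq> A" "cfun.span B \<noteq> A"
  shows "\<exists>e\<in>A. inner_L2 G e e = 1 \<and> (\<forall>b\<in>B. inner_L2 G b e = 0)"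
proof -
  have "cfun.span B \<subseteq> A" using cfun.span_minimal[OF B(2) A(2)] .
  then obtain f where f: "f \<in> A" "f \<notin> cfun.span B" using B(3) by blast
  let ?p = "\<Sum>b\<in>B. cscale (inner_L2 G b f) b"
  have p: "?p \<in> cfun.span B"
    by (intro cfun.span_sum cfun.span_scale cfun.span_base)
  define h where "h = f - ?p"
  have "h \<noteq> 0" using p f(2) by (auto simp: h_def)
  have "?p \<in> A" using p \<open>cfun.span B \<subseteq> A\<close> by blast
  then have hA: "h \<in> A" unfolding h_def using f(1) cfun.subspace_diff[OF A(2)] by blast
  obtain c where c: "inner_L2 G (cscale c h) (cscale c h) = 1"
    using normalize \<open>h \<noteq> 0\<close> hA A by blast
  have "inner_L2 G b h = 0" if "b \<in> B" for b
    unfolding h_def inner_diff_right orthonormal_inner_sum[OF B(1) order_refl that] by simp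
  then show ?thesis using c cfun.subspace_scale[OF A(2) hA, of c]
    by (intro bexI[of _ "cscale c h"]) (auto simp: inner_scale_right)
qed

lemma orthonormal_basis_exists:
  assumes "A \<subseteq> L2 G" "cfun.subspace A"
  obtains B where "orthonormal G B" "cfun.span B = A"
  using orthonormal_basis_extension[OF assms, of "\<lambda>_. True"] orthogonal_unit_vector_exists[OF assms]
  by blast

text \<open>Indexing a basis by an initial segment of the naturals allows operators on the span to
  be written as matrices.\<close>

lemma orthonormal_enumeration:
  assumes "orthonormal G B"
  obtains b where "bij_betw b {..<card B} B"
    "\<And>i j. i < card B \<Longrightarrow> j < card B \<Longrightarrow> inner_L2 G (b i) (b j) = (if i = j then 1 else 0)"
    "\<And>f. f \<in> cfun.span B \<Longrightarrow> f = (\<Sum>i<card B. cscale (inner_L2 G (b i) f) (b i))"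
proof -
  have "finite B" using assms by (simp add: orthonormal_def)
  then obtain b where b: "bij_betw b {..<card B} B"
    using ex_bij_betw_nat_finite by (metis atLeast0LessThan)
  show ?thesis
  proof
    show "bij_betw b {..<card B} B" by fact
    show "inner_L2 G (b i) (b j) = (if i = j then 1 else 0)" if "i < card B" "j < card B" for i j
    proof -
      have "b i \<in> B" "b j \<in> B" using b that by (auto simp: bij_betw_def)
      moreover have "b i = b j \<longleftrightarrow> i = j" using b that by (auto simp: bij_betw_def inj_on_def)
      ultimately show ?thesis using assms by (simp add: orthonormal_def)
    qed
    show "f = (\<Sum>i<card B. cscale (inner_L2 G (b i) f) (b i))" if "f \<in> cfun.span B" for f
    proof -
      have "f = (\<Sum>e\<in>B. cscale (inner_L2 G e f) e)" by (rule orthonormal_expansion[OF assms that])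
      also have "\<dots> = (\<Sum>i<card B. cscale (inner_L2 G (b i) f) (b i))"
        by (rule sum.reindex_bij_betw[OF b, symmetric])
      finally show ?thesis .
    qed
  qed
qed

section \<open>Operators and traces\<close>

lemma linear_operator_zero: "linear_operator G T \<Longrightarrow> T 0 = 0"
  using cfun.subspace_0[OF L2_subspace] cfun.scale_zero_left
  unfolding linear_operator_def by metis

lemma linear_operator_sum:
  assumes T: "linear_operator G T" and F: "\<And>i. i \<in> I \<Longrightarrow> F i \<in> L2 G"
  shows "T (\<Sum>i\<in>I. cscale (c i) (F i)) = (\<Sum>i\<in>I. cscale (c i) (T (F i)))"
  using F
proof (induction I rule: infinite_finite_induct)
  case (insert x I)
  have "T (cscale (c x) (F x) + (\<Sum>i\<in>I. cscale (c i) (F i))) =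
    T (cscale (c x) (F x)) + T (\<Sum>i\<in>I. cscale (c i) (F i))"
    using T L2_scale[of "F x"] L2_sum[of I "\<lambda>i. cscale (c i) (F i)"] L2_scale insert.prems
    unfolding linear_operator_def by simp
  moreover have "T (cscale (c x) (F x)) = cscale (c x) (T (F x))"
    using T insert.prems unfolding linear_operator_def by auto
  ultimately show ?case using insert by (simp del: plus_fun_apply)
qed (simp_all add: linear_operator_zero[OF T] del: zero_fun_apply)

text \<open>Expand \<open>T e\<close> in \<open>B'\<close>, exchange the two sums, and recognise the
  expansion of \<open>f\<close> in \<open>B\<close>; invariance of the span is what allows the first
  expansion.\<close>

lemma trace_basis_independent:
  assumes T: "linear_operator G T" and inv: "\<And>f. f \<in> cfun.span B \<Longrightarrow> T f \<in> cfun.span B"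
    and B: "orthonormal G B" "orthonormal G B'" "cfun.span B = cfun.span B'"
  shows "operator_trace G B T = operator_trace G B' T"
proof -
  have L2: "B \<subseteq> L2 G" "B' \<subseteq> L2 G" using B by (auto simp: orthonormal_def)
  have "operator_trace G B T = (\<Sum>e\<in>B. \<Sum>f\<in>B'. inner_L2 G f (T e) * inner_L2 G e f)"
    unfolding operator_trace_def
  proof (intro sum.cong refl)
    fix e assume "e \<in> B"
    then have "T e \<in> cfun.span B'" using inv B(3) cfun.span_base by metis
    then have "inner_L2 G e (T e) = inner_L2 G e (\<Sum>f\<in>B'. cscale (inner_L2 G f (T e)) f)"
      using orthonormal_expansion[OF B(2)] by metis
    then show "inner_L2 G e (T e) = (\<Sum>f\<in>B'. inner_L2 G f (T e) * inner_L2 G e f)"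
      by (simp add: inner_sum_right inner_scale_right)
  qed
  also have "\<dots> = (\<Sum>f\<in>B'. \<Sum>e\<in>B. inner_L2 G f (T e) * inner_L2 G e f)" by (rule sum.swap)
  also have "\<dots> = operator_trace G B' T"
    unfolding operator_trace_def
  proof (intro sum.cong refl)
    fix f assume "f \<in> B'"
    then have "f \<in> cfun.span B" using B(3) cfun.span_base by metis
    then have "T f = T (\<Sum>e\<in>B. cscale (inner_L2 G e f) e)"
      using orthonormal_expansion[OF B(1)] by metis
    also have "\<dots> = (\<Sum>e\<in>B. cscale (inner_L2 G e f) (T e))"
      using L2 by (intro linear_operator_sum[OF T]) blast
    finally show "(\<Sum>e\<in>B. inner_L2 G f (T e) * inner_L2 G e f) = inner_L2 G f (T f)"
      by (simp add: inner_sum_right inner_scale_right mult.commute)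
  qed
  finally show ?thesis .
qed

section \<open>Spectral theory on invariant subspaces\<close>

text \<open>In an orthonormal basis the operator becomes a complex matrix, whose spectrum is
  nonempty; the entries of an eigenvector of the matrix are the coordinates of
  \<open>f\<close>.\<close>

lemma eigenvector_exists:
  assumes A: "A \<subseteq> L2 G" "cfun.subspace A" "A \<noteq> {0}"
    and T: "linear_operator G T" "\<And>f. f \<in> A \<Longrightarrow> T f \<in> A"
  shows "\<exists>f\<in>A. f \<noteq> 0 \<and> (\<exists>l. T f = cscale l f)"
proof -
  obtain B where B: "orthonormal G B" "cfun.span B = A" using orthonormal_basis_exists[OF A(1,2)] .
  define n where "n = card B"
  obtain b where b: "bij_betw b {..<n} B"
    and orth: "\<And>i j. i < n \<Longrightarrow> j < n \<Longrightarrow> inner_L2 G (b i) (b j) = (if i = j then 1 else 0)"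
    and exp: "\<And>f. f \<in> A \<Longrightarrow> f = (\<Sum>i<n. cscale (inner_L2 G (b i) f) (b i))"
    by (rule orthonormal_enumeration[OF B(1), unfolded B(2), folded n_def]) blast
  have bB: "b i \<in> B" if "i < n" for i using b that by (auto simp: bij_betw_def)
  then have bA: "b i \<in> A" if "i < n" for i using that B(2) cfun.span_base by metis
  \<comment> \<open>A matrix of size 0 has no eigenvalue; this is where
    \<open>A \<noteq> {0}\<close> enters.\<close>
  have "n \<noteq> 0"
  proof
    assume "n = 0"
    then have "B = {}" using B(1) by (simp add: n_def orthonormal_def)
    then show False using A(3) B(2) by auto
  qed
  define M where "M = mat n n (\<lambda>(i, j). inner_L2 G (b i) (T (b j)))"
  have M: "M \<in> carrier_mat n n" by (simp add: M_def)
  obtain l where "eigenvalue M l" using spectrum_non_empty[OF M] \<open>n \<noteq> 0\<close> by (auto simp: spectrum_def)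
  then obtain v where v: "v \<in> carrier_vec n" "v \<noteq> 0\<^sub>v n" "M *\<^sub>v v = l \<cdot>\<^sub>v v"
    using M by (auto simp: eigenvalue_def eigenvector_def)
  have Mv: "(\<Sum>j<n. inner_L2 G (b i) (T (b j)) * v $ j) = l * v $ i" if "i < n" for i
  proof -
    have "(M *\<^sub>v v) $ i = (\<Sum>j<n. inner_L2 G (b i) (T (b j)) * v $ j)"
      using that v(1) by (auto simp: M_def mult_mat_vec_def scalar_prod_def atLeast0LessThan)
    then show ?thesis using v(1,3) that by simp
  qed
  define f where "f = (\<Sum>j<n. cscale (v $ j) (b j))"
  have fA: "f \<in> A" unfolding f_def using bA A(2)
    by (auto intro!: cfun.subspace_sum cfun.subspace_scale)
  have coord: "inner_L2 G (b i) f = v $ i" if "i < n" for i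
  proof -
    have "inner_L2 G (b i) f = (\<Sum>j<n. if j = i then v $ i else 0)"
      unfolding f_def inner_sum_right inner_scale_right
      using that orth by (intro sum.cong refl) auto
    then show ?thesis using that by simp
  qed
  have "f \<noteq> 0"
  proof
    assume "f = 0"
    then have "v = 0\<^sub>v n" using coord v(1) by (intro eq_vecI) auto
    then show False using v(2) by simp
  qed
  moreover have "T f = cscale l f"
  proof -
    have Tf: "T f = (\<Sum>j<n. cscale (v $ j) (T (b j)))"
      unfolding f_def using bA A(1) by (intro linear_operator_sum[OF T(1)]) auto
    have "inner_L2 G (b i) (T f) = l * v $ i" if "i < n" for i
      unfolding Tf inner_sum_right inner_scale_right Mv[OF that, symmetric] by (simp add: mult.commute)
    then have "T f = (\<Sum>i<n. cscale (l * v $ i) (b i))"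
      by (subst exp[OF T(2)[OF fA]]) simp
    then show ?thesis by (simp add: f_def cfun.scale_sum_right)
  qed
  ultimately show ?thesis using fA by blast
qed

text \<open>An orthonormal set of eigenvectors that does not yet span \<open>A\<close> can be
  enlarged: its orthogonal complement in \<open>A\<close> is nonzero and, by hermiticity, again
  \<open>T\<close>-invariant, so it contains an eigenvector.\<close>

lemma spectral_theorem:
  assumes T: "hermitian_operator G T"
    and A: "A \<subseteq> L2 G" "cfun.subspace A" "\<And>f. f \<in> A \<Longrightarrow> T f \<in> A"
  obtains B where "orthonormal G B" "cfun.span B = A"
    "\<And>e. e \<in> B \<Longrightarrow> T e = cscale (inner_L2 G e (T e)) e"
proof -
  have lin: "linear_operator G T" using T by (simp add: hermitian_operator_def)
  have sym: "inner_L2 G f (T h) = inner_L2 G (T f) h" if "f \<in> A" "h \<in> A" for f h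
    using T that A(1) by (auto simp: hermitian_operator_def)
  have "\<exists>B. orthonormal G B \<and> cfun.span B = A \<and> (\<forall>e\<in>B. \<exists>l. T e = cscale l e)"
  proof (rule orthonormal_basis_extension[OF A(1,2)])
    fix B assume B: "orthonormal G B" "B \<subseteq> A" "\<forall>e\<in>B. \<exists>l. T e = cscale l e" "cfun.span B \<noteq> A"
    let ?C = "{f\<in>A. \<forall>b\<in>B. inner_L2 G b f = 0}"
    have "\<exists>f\<in>?C. f \<noteq> 0 \<and> (\<exists>l. T f = cscale l f)"
    proof (rule eigenvector_exists[OF _ _ _ lin])
      show "?C \<subseteq> L2 G" using A(1) by blast
      show "cfun.subspace ?C"
        using A(2) by (auto simp: cfun.subspace_def inner_add_right inner_scale_right)
      obtain e where e: "e \<in> ?C" "inner_L2 G e e = 1"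
        using orthogonal_unit_vector_exists[OF A(1,2) B(1,2,4)] by blast
      then have "e \<noteq> 0" by auto
      then show "?C \<noteq> {0}" using e(1) by blast
      fix f assume f: "f \<in> ?C"
      have "inner_L2 G b (T f) = 0" if "b \<in> B" for b
      proof -
        from B(3) that obtain l where l: "T b = cscale l b" by blast
        have "inner_L2 G b (T f) = inner_L2 G (T b) f" using sym that f B(2) by blast
        also have "\<dots> = 0" unfolding l inner_scale_left using that f by simp
        finally show ?thesis .
      qed
      then show "T f \<in> ?C" using f A(3) by blast
    qed
    then obtain f l where f: "f \<in> ?C" "f \<noteq> 0" "T f = cscale l f" by blast
    then obtain c where c: "inner_L2 G (cscale c f) (cscale c f) = 1" using normalize A(1) by blast
    have "T (cscale c f) = cscale l (cscale c f)"
      using lin f A(1) unfolding linear_operator_def by (auto simp: mult.commute)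
    then show "\<exists>e\<in>A. (\<exists>l. T e = cscale l e) \<and> inner_L2 G e e = 1 \<and> (\<forall>b\<in>B. inner_L2 G b e = 0)"
      using c f(1) cfun.subspace_scale[OF A(2)]
      by (intro bexI[of _ "cscale c f"]) (auto simp: inner_scale_right)
  qed
  then obtain B where B: "orthonormal G B" "cfun.span B = A" "\<forall>e\<in>B. \<exists>l. T e = cscale l e" by blast
  \<comment> \<open>Pairing with the unit vector \<open>e\<close> identifies its eigenvalue.\<close>
  have "T e = cscale (inner_L2 G e (T e)) e" if e: "e \<in> B" for e
  proof -
    obtain l where "T e = cscale l e" using B(3) e by blast
    moreover have "inner_L2 G e e = 1" using B(1) e by (auto simp: orthonormal_def)
    ultimately show ?thesis by (simp add: inner_scale_right)
  qed
  then show thesis using that B by blast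
qed

text \<open>Replaces the eigenvalue mean by a quantity that is linear in \<open>T\<close>. An
  orthonormal eigenbasis \<open>E\<close> is grouped by eigenvalue, the group of \<open>l\<close>
  being a basis of the eigenspace of \<open>l\<close>. For empty \<open>B\<close> both sides are
  \<open>0 / 0 = 0\<close>.\<close>

lemma eigenvalue_mean_eq_trace:
  assumes T: "hermitian_operator G T"
    and B: "orthonormal G B" "\<And>f. f \<in> cfun.span B \<Longrightarrow> T f \<in> cfun.span B"
  shows "eigenvalue_mean T (cfun.span B) = operator_trace G B T / of_nat (card B)"
proof -
  define A where "A = cfun.span B"
  have lin: "linear_operator G T" using T by (simp add: hermitian_operator_def)
  have A: "A \<subseteq> L2 G" "cfun.subspace A" "\<And>f. f \<in> A \<Longrightarrow> T f \<in> A"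
    unfolding A_def using B cfun.span_minimal[OF _ L2_subspace] by (auto simp: orthonormal_def)
  obtain E where E: "orthonormal G E" "cfun.span E = A"
    and ev: "\<And>e. e \<in> E \<Longrightarrow> T e = cscale (inner_L2 G e (T e)) e"
    using spectral_theorem[OF T A] by metis
  define \<mu> where "\<mu> e = inner_L2 G e (T e)" for e
  have ev': "T e = cscale (\<mu> e) e" if "e \<in> E" for e
    unfolding \<mu>_def by (rule ev[OF that])
  have finE: "finite E" and EL2: "E \<subseteq> L2 G" using E by (auto simp: orthonormal_def)
  have eig: "eigenspace_on T A l = cfun.span {e\<in>E. \<mu> e = l}" for l
  proof
    show "eigenspace_on T A l \<subseteq> cfun.span {e\<in>E. \<mu> e = l}"
    proof
      fix f assume "f \<in> eigenspace_on T A l"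
      then have f: "f \<in> A" "T f = cscale l f" by (auto simp: eigenspace_on_def)
      have fexp: "f = (\<Sum>e\<in>E. cscale (inner_L2 G e f) e)"
        using orthonormal_expansion[OF E(1)] f(1) E(2) by blast
      have "T f = T (\<Sum>e\<in>E. cscale (inner_L2 G e f) e)" by (rule arg_cong[OF fexp])
      also have "\<dots> = (\<Sum>e\<in>E. cscale (inner_L2 G e f) (T e))"
        using EL2 by (intro linear_operator_sum[OF lin]) blast
      also have "\<dots> = (\<Sum>e\<in>E. cscale (inner_L2 G e f * \<mu> e) e)"
        by (intro sum.cong refl) (simp add: ev')
      finally have Tf: "T f = (\<Sum>e\<in>E. cscale (inner_L2 G e f * \<mu> e) e)" .
      \<comment> \<open>Comparing the coordinates of \<open>T f\<close> and
        \<open>cscale l f\<close> at \<open>e\<close> leaves only basis vectors with eigenvalue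
        \<open>l\<close>.\<close>
      have zero: "inner_L2 G e f = 0" if e: "e \<in> E" "\<mu> e \<noteq> l" for e
      proof -
        have "inner_L2 G e (T f) = inner_L2 G e f * \<mu> e"
          unfolding Tf by (rule orthonormal_inner_sum[OF E(1) order_refl e(1)])
        then have "l * inner_L2 G e f = inner_L2 G e f * \<mu> e" using f(2) by (simp add: inner_scale_right)
        then show ?thesis using e(2) by auto
      qed
      have "f = (\<Sum>e\<in>{e\<in>E. \<mu> e = l}. cscale (inner_L2 G e f) e)"
        by (subst fexp, rule sum.mono_neutral_right) (auto simp: finE zero)
      also have "\<dots> \<in> cfun.span {e\<in>E. \<mu> e = l}"
        by (intro cfun.span_sum cfun.span_scale cfun.span_base)
      finally show "f \<in> cfun.span {e\<in>E. \<mu> e = l}" .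
    qed
    show "cfun.span {e\<in>E. \<mu> e = l} \<subseteq> eigenspace_on T A l"
    proof (rule cfun.span_minimal)
      show "{e\<in>E. \<mu> e = l} \<subseteq> eigenspace_on T A l"
        using cfun.span_base[of _ E] by (auto simp: eigenspace_on_def ev' E(2))
      show "cfun.subspace (eigenspace_on T A l)"
        using A(1,2) lin unfolding cfun.subspace_def eigenspace_on_def linear_operator_def
        by (auto simp: subset_iff cfun.scale_right_distrib linear_operator_zero[OF lin] mult.commute)
    qed
  qed
  have dim: "cfun.dim (eigenspace_on T A l) = card {e\<in>E. \<mu> e = l}" for l
    unfolding eig
    by (intro cfun.dim_span_eq_card_independent orthonormal_independent orthonormal_mono[OF E(1)]) auto
  have evs: "eigenvalues_on T A = \<mu> ` E"
  proof -
    have "l \<in> eigenvalues_on T A \<longleftrightarrow> eigenspace_on T A l \<noteq> {0}" for l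
      unfolding eigenvalues_on_def eigenspace_on_def
      using cfun.subspace_0[OF A(2)] linear_operator_zero[OF lin] by auto
    moreover have "eigenspace_on T A l \<noteq> {0} \<longleftrightarrow> l \<in> \<mu> ` E" for l
    proof (cases "l \<in> \<mu> ` E")
      case True
      then obtain e where e: "e \<in> E" "\<mu> e = l" by blast
      then have "e \<in> eigenspace_on T A l" unfolding eig by (intro cfun.span_base) simp
      moreover have "e \<noteq> 0" using e(1) E(1) by (metis inner_zero_left orthonormal_def zero_neq_one)
      ultimately show ?thesis using True by blast
    next
      case False
      then have empty: "{e\<in>E. \<mu> e = l} = {}" by auto
      then have "eigenspace_on T A l = {0}" unfolding eig empty by (simp only: cfun.span_empty)
      then show ?thesis using False by simp
    qed
    ultimately show ?thesis by blast
  qed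
  \<comment> \<open>Summing the eigenvalues with multiplicity is summing \<open>\<mu>\<close> over
    \<open>E\<close>; basis independence then passes from \<open>E\<close> to
    \<open>B\<close>.\<close>
  have "(\<Sum>l\<in>\<mu> ` E. of_nat (card {e\<in>E. \<mu> e = l}) * l) = (\<Sum>l\<in>\<mu> ` E. \<Sum>e\<in>{e\<in>E. \<mu> e = l}. \<mu> e)"
    by (intro sum.cong refl) simp
  also have "\<dots> = (\<Sum>e\<in>E. \<mu> e)" by (rule sum.image_gen[OF finE, symmetric])
  also have "\<dots> = operator_trace G E T" by (simp add: \<mu>_def operator_trace_def)
  also have "\<dots> = operator_trace G B T"
    using trace_basis_independent[OF lin _ E(1) B(1)] E(2) A(3) by (simp add: A_def)
  finally have num: "(\<Sum>l\<in>\<mu> ` E. of_nat (card {e\<in>E. \<mu> e = l}) * l) = operator_trace G B T" .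
  have "(\<Sum>l\<in>\<mu> ` E. of_nat (card {e\<in>E. \<mu> e = l}) :: complex) =
      (\<Sum>l\<in>\<mu> ` E. \<Sum>e\<in>{e\<in>E. \<mu> e = l}. 1)"
    by simp
  also have "\<dots> = (\<Sum>e\<in>E. 1)" by (rule sum.image_gen[OF finE, symmetric])
  also have "\<dots> = of_nat (card E)" by simp
  also have "card E = card B"
    using cfun.dim_span_eq_card_independent[OF orthonormal_independent[OF E(1)]]
      cfun.dim_span_eq_card_independent[OF orthonormal_independent[OF B(1)]] E(2)
    by (simp add: A_def)
  finally have den: "(\<Sum>l\<in>\<mu> ` E. of_nat (card {e\<in>E. \<mu> e = l}) :: complex) = of_nat (card B)" .
  show ?thesis unfolding eigenvalue_mean_def A_def[symmetric] evs dim num den ..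
qed

section \<open>Right translations and convolution operators\<close>

definition right_invariant :: "('a \<Rightarrow> complex) set \<Rightarrow> bool" where
  "right_invariant U \<longleftrightarrow> (\<forall>x\<in>carrier G. \<forall>f\<in>U. right_translation G x f \<in> U)"

lemma right_translation_L2: "right_translation G x f \<in> L2 G"
  by (simp add: right_translation_def on_carrier_L2)

lemma right_translation_apply: "g \<in> carrier G \<Longrightarrow> right_translation G x f g = f (g \<otimes> x)"
  by (simp add: right_translation_def on_carrier_def)

lemma right_translation_linear: "linear_operator G (right_translation G x)"
  unfolding linear_operator_def
  by (auto simp: right_translation_L2) (auto simp: right_translation_def on_carrier_def cscale_def)

lemma right_translation_mult:
  "x \<in> carrier G \<Longrightarrow> y \<in> carrier G \<Longrightarrow>
     right_translation G x (right_translation G y f) = right_translation G (x \<otimes> y) f"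
  by (auto simp: right_translation_def on_carrier_def m_assoc)

lemma right_translation_one: "f \<in> L2 G \<Longrightarrow> right_translation G \<one> f = f"
  by (auto simp: right_translation_def on_carrier_def L2_def)

lemma sum_right_mult:
  assumes "x \<in> carrier G"
  shows "(\<Sum>g\<in>carrier G. F (g \<otimes> x)) = (\<Sum>g\<in>carrier G. F g)"
  by (rule sum.reindex_bij_witness[of _ "\<lambda>g. g \<otimes> inv x" "\<lambda>g. g \<otimes> x"])
    (use assms in \<open>auto simp: m_assoc\<close>)

lemma sum_left_mult:
  assumes "x \<in> carrier G"
  shows "(\<Sum>g\<in>carrier G. F (x \<otimes> g)) = (\<Sum>g\<in>carrier G. F g)"
  by (rule sum.reindex_bij_witness[of _ "\<lambda>g. inv x \<otimes> g" "\<lambda>g. x \<otimes> g"])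
    (use assms in \<open>auto simp: m_assoc[symmetric]\<close>)

lemma sum_inv: "(\<Sum>g\<in>carrier G. F (inv g)) = (\<Sum>g\<in>carrier G. F g)"
  by (rule sum.reindex_bij_witness[of _ "\<lambda>g. inv g" "\<lambda>g. inv g"]) auto

lemma inner_right_translation:
  assumes "x \<in> carrier G"
  shows "inner_L2 G (right_translation G x f) (right_translation G x h) = inner_L2 G f h"
  using sum_right_mult[OF assms, of "\<lambda>g. cnj (f g) * h g"]
  by (simp add: inner_L2_def right_translation_apply)

lemma right_translation_adjoint:
  assumes "x \<in> carrier G" "f \<in> L2 G"
  shows "inner_L2 G f (right_translation G x h) = inner_L2 G (right_translation G (inv x) f) h"
  using inner_right_translation[OF assms(1), of "right_translation G (inv x) f" h] assms
  by (simp add: right_translation_mult right_translation_one)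

section \<open>Convolution operators as combinations of right translations\<close>

text \<open>Substitute \<open>h = g \<otimes> x\<close> in the defining sum, so that the kernel
  value no longer depends on \<open>g\<close>.\<close>

lemma conv_operator_apply:
  assumes "g \<in> carrier G"
  shows "conv_operator G \<delta> f g = (\<Sum>x\<in>carrier G. \<delta> x * f (g \<otimes> x))"
  using sum_left_mult[OF assms, of "\<lambda>h. \<delta> (inv g \<otimes> h) * f h"] assms
  by (simp add: conv_operator_def on_carrier_def m_assoc[symmetric])

lemma conv_operator_L2: "conv_operator G \<delta> f \<in> L2 G"
  by (simp add: conv_operator_def on_carrier_L2)

text \<open>Reduces hermiticity, traces and invariance of subspaces under convolution to the same
  questions for right translations.\<close>

lemma conv_operator_eq_sum:
  "conv_operator G \<delta> f = (\<Sum>x\<in>carrier G. cscale (\<delta> x) (right_translation G x f))"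
proof (rule L2_eqI)
  show "(\<Sum>x\<in>carrier G. cscale (\<delta> x) (right_translation G x f)) \<in> L2 G"
    by (intro L2_sum L2_scale right_translation_L2)
qed (simp_all add: conv_operator_L2 conv_operator_apply sum_fun_apply cscale_def right_translation_apply)

lemma conv_operator_linear: "linear_operator G (conv_operator G \<delta>)"
  unfolding linear_operator_def
  by (auto simp: conv_operator_L2)
    (auto simp: conv_operator_def on_carrier_def cscale_def algebra_simps sum.distrib sum_distrib_left)

lemma conv_operator_diff:
  "conv_operator G (\<lambda>x. \<delta> x - \<epsilon> x) f = conv_operator G \<delta> f - conv_operator G \<epsilon> f"
  by (auto simp: conv_operator_def on_carrier_def algebra_simps sum_subtractf)

text \<open>The adjoint of translation by \<open>x\<close> is translation by \<open>inv x\<close>;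
  reindexing the sum by inversion turns the conjugated coefficients back into values of
  \<open>\<delta>\<close>.\<close>

lemma conv_operator_hermitian:
  assumes "\<And>x. x \<in> carrier G \<Longrightarrow> \<delta> (inv x) = cnj (\<delta> x)"
  shows "hermitian_operator G (conv_operator G \<delta>)"
proof -
  have "inner_L2 G f (conv_operator G \<delta> h) = inner_L2 G (conv_operator G \<delta> f) h" if "f \<in> L2 G" for f h
  proof -
    have "inner_L2 G (conv_operator G \<delta> f) h =
        (\<Sum>x\<in>carrier G. cnj (\<delta> x) * inner_L2 G (right_translation G x f) h)"
      unfolding conv_operator_eq_sum inner_sum_left inner_scale_left ..
    also have "\<dots> = (\<Sum>x\<in>carrier G. cnj (\<delta> (inv x)) * inner_L2 G (right_translation G (inv x) f) h)"
      by (rule sum_inv[symmetric])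
    also have "\<dots> = (\<Sum>x\<in>carrier G. \<delta> x * inner_L2 G f (right_translation G x h))"
      using that by (intro sum.cong refl) (simp add: assms right_translation_adjoint)
    also have "\<dots> = inner_L2 G f (conv_operator G \<delta> h)"
      unfolding conv_operator_eq_sum inner_sum_right inner_scale_right ..
    finally show ?thesis ..
  qed
  then show ?thesis by (simp add: hermitian_operator_def conv_operator_linear)
qed

text \<open>Test hermiticity on the point masses at \<open>x\<close> and \<open>\<one>\<close>: the
  two inner products pick out \<open>\<delta> (inv x)\<close> and \<open>cnj (\<delta> x)\<close>,
  each divided by the group order.\<close>

lemma hermitian_conv_kernel:
  assumes "hermitian_operator G (conv_operator G \<delta>)" and x: "x \<in> carrier G"
  shows "\<delta> (inv x) = cnj (\<delta> x)"
proof -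
  define d where "d y = (\<lambda>g. if g = y then 1 else 0 :: complex)" for y :: 'a
  have d: "d y \<in> L2 G" if "y \<in> carrier G" for y using that by (auto simp: d_def L2_def)
  have conv: "conv_operator G \<delta> (d y) g = \<delta> (inv g \<otimes> y)" if "y \<in> carrier G" "g \<in> carrier G" for y g
    using that finite_carrier
    by (simp add: conv_operator_def on_carrier_def d_def if_distrib cong: if_cong)
  have "inner_L2 G (d x) (conv_operator G \<delta> (d \<one>)) = inner_L2 G (conv_operator G \<delta> (d x)) (d \<one>)"
    using assms d by (simp add: hermitian_operator_def)
  moreover have "inner_L2 G (d x) h = h x / card (carrier G)" for h
    using x finite_carrier by (simp add: inner_L2_def d_def if_distrib if_distribR cong: if_cong)
  moreover have "inner_L2 G h (d \<one>) = cnj (h \<one>) / card (carrier G)" for h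
    using finite_carrier by (simp add: inner_L2_def d_def if_distrib if_distribR cong: if_cong)
  ultimately show ?thesis using conv x card_carrier_pos by simp
qed

text \<open>Replacing the summation variable \<open>x\<close> by
  \<open>a \<otimes> x \<otimes> inv a\<close> leaves the kernel unchanged and turns the argument
  \<open>g \<otimes> x \<otimes> a\<close> into \<open>g \<otimes> a \<otimes> x\<close>.\<close>

lemma conv_operator_right_translation:
  assumes a: "a \<in> carrier G"
    and \<delta>: "\<And>x. x \<in> carrier G \<Longrightarrow> \<delta> (a \<otimes> x \<otimes> inv a) = \<delta> x"
  shows "conv_operator G \<delta> (right_translation G a f) = right_translation G a (conv_operator G \<delta> f)"
proof (rule L2_eqI)
  fix g assume g: "g \<in> carrier G"
  have "conv_operator G \<delta> (right_translation G a f) g = (\<Sum>x\<in>carrier G. \<delta> x * f (g \<otimes> x \<otimes> a))"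
    using g by (simp add: conv_operator_apply right_translation_apply)
  also have "\<dots> = (\<Sum>x\<in>carrier G. \<delta> (a \<otimes> x) * f (g \<otimes> (a \<otimes> x) \<otimes> a))"
    by (rule sum_left_mult[OF a, symmetric])
  also have "\<dots> = (\<Sum>x\<in>carrier G. \<delta> (a \<otimes> (x \<otimes> inv a)) * f (g \<otimes> (a \<otimes> (x \<otimes> inv a)) \<otimes> a))"
    by (rule sum_right_mult[symmetric]) (use a in simp)
  also have "\<dots> = (\<Sum>x\<in>carrier G. \<delta> x * f (g \<otimes> a \<otimes> x))"
    using \<delta> a g by (intro sum.cong refl) (simp add: m_assoc)
  also have "\<dots> = right_translation G a (conv_operator G \<delta> f) g"
    using a g by (simp add: conv_operator_apply right_translation_apply)
  finally show "conv_operator G \<delta> (right_translation G a f) g =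
    right_translation G a (conv_operator G \<delta> f) g" .
qed (auto intro: conv_operator_L2 right_translation_L2)

section \<open>Conjugation averages and traces\<close>

lemma sum_conj:
  assumes "a \<in> carrier G"
  shows "(\<Sum>x\<in>carrier G. F (a \<otimes> x \<otimes> inv a)) = (\<Sum>x\<in>carrier G. F x)"
  using sum_left_mult[OF assms, of "\<lambda>x. F (x \<otimes> inv a)"] sum_right_mult[of "inv a" F] assms by simp

text \<open>Conjugating the argument by \<open>a\<close> shifts the averaging variable from
  \<open>b\<close> to \<open>b \<otimes> a\<close>, which runs over the group as well.\<close>

lemma conj_average_conj:
  assumes "a \<in> carrier G" "x \<in> carrier G"
  shows "conj_average G \<phi> (a \<otimes> x \<otimes> inv a) = conj_average G \<phi> x"
proof -
  have "(\<Sum>b\<in>carrier G. \<phi> (b \<otimes> (a \<otimes> x \<otimes> inv a) \<otimes> inv b)) =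
      (\<Sum>b\<in>carrier G. \<phi> (b \<otimes> a \<otimes> x \<otimes> inv (b \<otimes> a)))"
    using assms by (intro sum.cong refl) (simp add: m_assoc inv_mult_group)
  also have "\<dots> = (\<Sum>b\<in>carrier G. \<phi> (b \<otimes> x \<otimes> inv b))"
    using sum_right_mult[OF assms(1), of "\<lambda>b. \<phi> (b \<otimes> x \<otimes> inv b)"] .
  finally show ?thesis using assms by (simp add: conj_average_def on_carrier_def)
qed

lemma conj_average_inv:
  assumes "x \<in> carrier G" "\<And>x. x \<in> carrier G \<Longrightarrow> \<phi> (inv x) = cnj (\<phi> x)"
  shows "conj_average G \<phi> (inv x) = cnj (conj_average G \<phi> x)"
proof -
  have "\<phi> (a \<otimes> inv x \<otimes> inv a) = cnj (\<phi> (a \<otimes> x \<otimes> inv a))" if "a \<in> carrier G" for a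
    using assms(1) that by (subst assms(2)[symmetric]) (auto simp: inv_mult_group m_assoc)
  then show ?thesis using assms(1) by (simp add: conj_average_def on_carrier_def)
qed

lemma trace_conv_operator:
  "operator_trace G B (conv_operator G \<delta>) =
     (\<Sum>x\<in>carrier G. \<delta> x * operator_trace G B (right_translation G x))"
  unfolding operator_trace_def conv_operator_eq_sum inner_sum_right inner_scale_right
    sum_distrib_left
  by (rule sum.swap)

text \<open>Conjugating translation by \<open>x\<close> with translation by \<open>a\<close> amounts
  to taking its trace in the basis translated by \<open>inv a\<close>, which is another orthonormal
  basis of the same space.\<close>

lemma trace_right_translation_conj:
  assumes B: "orthonormal G B"
    and inv: "right_invariant (cfun.span B)"
    and ax: "a \<in> carrier G" "x \<in> carrier G"
  shows "operator_trace G B (right_translation G (a \<otimes> x \<otimes> inv a)) =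
    operator_trace G B (right_translation G x)"
proof -
  let ?R = "right_translation G"
  have BL2: "B \<subseteq> L2 G" using B by (simp add: orthonormal_def)
  have inner: "inner_L2 G (?R (inv a) e) (?R (inv a) f) = inner_L2 G e f" for e f
    using inner_right_translation ax by blast
  have inj: "inj_on (?R (inv a)) B"
  proof (rule inj_on_inverseI)
    fix e assume "e \<in> B"
    then show "?R a (?R (inv a) e) = e"
      using ax BL2 by (auto simp: right_translation_mult right_translation_one)
  qed
  have B': "orthonormal G (?R (inv a) ` B)"
    using B inj_on_eq_iff[OF inj] by (auto simp: orthonormal_def inner right_translation_L2)
  have R_span: "?R x f \<in> cfun.span B" if "x \<in> carrier G" "f \<in> cfun.span B" for x f
    using inv that by (simp add: right_invariant_def)
  then have sub: "?R (inv a) ` B \<subseteq> cfun.span B" using ax by (auto intro: cfun.span_base)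
  \<comment> \<open>Translation by \<open>a\<close> would send a unit vector \<open>e\<close>
    orthogonal to the translated basis to a vector of \<open>span B\<close> orthogonal to all of
    \<open>B\<close>, hence to 0, although it preserves norms.\<close>
  have span: "cfun.span (?R (inv a) ` B) = cfun.span B"
  proof (rule ccontr)
    assume "cfun.span (?R (inv a) ` B) \<noteq> cfun.span B"
    moreover have "cfun.span B \<subseteq> L2 G" using cfun.span_minimal[OF BL2 L2_subspace] .
    ultimately obtain e where e: "e \<in> cfun.span B" "inner_L2 G e e = 1"
        "\<forall>b\<in>?R (inv a) ` B. inner_L2 G b e = 0"
      using orthogonal_unit_vector_exists[OF _ cfun.subspace_span B' sub] by blast
    have "?R a e \<in> cfun.span B" using R_span ax e(1) by blast
    then have "?R a e = (\<Sum>b\<in>B. cscale (inner_L2 G b (?R a e)) b)"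
      by (rule orthonormal_expansion[OF B])
    also have "\<dots> = 0"
      using e(3) ax BL2 by (intro sum.neutral) (auto simp: right_translation_adjoint)
    finally have "inner_L2 G (?R a e) (?R a e) = 0" by simp
    then show False using e(2) inner_right_translation ax by simp
  qed
  have "operator_trace G B (?R (a \<otimes> x \<otimes> inv a)) =
      (\<Sum>e\<in>B. inner_L2 G (?R (inv a) e) (?R x (?R (inv a) e)))"
    unfolding operator_trace_def
  proof (intro sum.cong refl)
    fix e assume "e \<in> B"
    then have "e \<in> L2 G" using BL2 by blast
    then show "inner_L2 G e (?R (a \<otimes> x \<otimes> inv a) e) = inner_L2 G (?R (inv a) e) (?R x (?R (inv a) e))"
      using right_translation_adjoint[OF ax(1), of e "?R (x \<otimes> inv a) e"] ax
      by (simp add: right_translation_mult m_assoc)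
  qed
  also have "\<dots> = operator_trace G (?R (inv a) ` B) (?R x)"
    unfolding operator_trace_def by (simp add: sum.reindex[OF inj])
  also have "\<dots> = operator_trace G B (?R x)"
    using trace_basis_independent[OF right_translation_linear _ B' B span] R_span ax(2) span by simp
  finally show ?thesis .
qed

text \<open>The trace \<open>\<theta>\<close> of right translations on an invariant space is a
  character, hence a class function, and pairing with a class function does not see the averaging of
  \<open>\<phi>\<close> over conjugation.\<close>

lemma trace_conj_average:
  assumes B: "orthonormal G B"
    and inv: "right_invariant (cfun.span B)"
  shows "operator_trace G B (conv_operator G (conj_average G \<phi>)) =
    operator_trace G B (conv_operator G \<phi>)"
proof -
  define \<theta> where "\<theta> x = operator_trace G B (right_translation G x)" for x
  have \<theta>: "\<theta> (a \<otimes> x \<otimes> inv a) = \<theta> x" if "a \<in> carrier G" "x \<in> carrier G" for a x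
    unfolding \<theta>_def using trace_right_translation_conj[OF B inv that] .
  have "operator_trace G B (conv_operator G (conj_average G \<phi>)) =
      (\<Sum>x\<in>carrier G. 1 / card (carrier G) * (\<Sum>a\<in>carrier G. \<phi> (a \<otimes> x \<otimes> inv a) * \<theta> x))"
    unfolding trace_conv_operator \<theta>_def[symmetric]
    by (intro sum.cong refl) (simp add: conj_average_def on_carrier_def sum_distrib_right)
  also have "\<dots> = 1 / card (carrier G) *
      (\<Sum>a\<in>carrier G. \<Sum>x\<in>carrier G. \<phi> (a \<otimes> x \<otimes> inv a) * \<theta> x)"
    unfolding sum_distrib_left by (rule sum.swap)
  \<comment> \<open>For each \<open>a\<close> the substitution of
    \<open>a \<otimes> x \<otimes> inv a\<close> for \<open>x\<close> removes \<open>a\<close> from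
    the inner sum, so the average is over equal terms.\<close>
  also have "(\<Sum>a\<in>carrier G. \<Sum>x\<in>carrier G. \<phi> (a \<otimes> x \<otimes> inv a) * \<theta> x) =
      (\<Sum>a\<in>carrier G. \<Sum>x\<in>carrier G. \<phi> x * \<theta> x)"
  proof (rule sum.cong[OF refl])
    fix a assume a: "a \<in> carrier G"
    have "(\<Sum>x\<in>carrier G. \<phi> (a \<otimes> x \<otimes> inv a) * \<theta> x) =
        (\<Sum>x\<in>carrier G. \<phi> (a \<otimes> x \<otimes> inv a) * \<theta> (a \<otimes> x \<otimes> inv a))"
      using \<theta> a by (intro sum.cong refl) simp
    then show "(\<Sum>x\<in>carrier G. \<phi> (a \<otimes> x \<otimes> inv a) * \<theta> x) = (\<Sum>x\<in>carrier G. \<phi> x * \<theta> x)"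
      using sum_conj[OF a, of "\<lambda>x. \<phi> x * \<theta> x"] by simp
  qed
  also have "1 / card (carrier G) * (\<Sum>a\<in>carrier G. \<Sum>x\<in>carrier G. \<phi> x * \<theta> x) =
      operator_trace G B (conv_operator G \<phi>)"
    using card_carrier_pos unfolding trace_conv_operator \<theta>_def[symmetric] by simp
  finally show ?thesis .
qed

section \<open>Irreducible representations inside \<open>L2 G\<close>\<close>

lemma matrix_rep_mult_entry:
  assumes "matrix_rep G \<sigma>" "g \<in> carrier G" "h \<in> carrier G" "i < rep_dim G \<sigma>" "j < rep_dim G \<sigma>"
  shows "\<sigma> (g \<otimes> h) $$ (i, j) = (\<Sum>k<rep_dim G \<sigma>. \<sigma> g $$ (i, k) * \<sigma> h $$ (k, j))"
proof -
  have "\<sigma> g \<in> carrier_mat (rep_dim G \<sigma>) (rep_dim G \<sigma>)" "\<sigma> h \<in> carrier_mat (rep_dim G \<sigma>) (rep_dim G \<sigma>)"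
    "\<sigma> (g \<otimes> h) = \<sigma> g * \<sigma> h"
    using assms by (auto simp: matrix_rep_def)
  then show ?thesis using assms(4,5) by (simp add: scalar_prod_def atLeast0LessThan)
qed

lemma matrix_coeff_space_L2: "matrix_coeff_space G \<sigma> \<subseteq> L2 G"
  unfolding matrix_coeff_space_def by (rule cfun.span_minimal[OF _ L2_subspace]) (auto simp: on_carrier_L2)

lemma matrix_coeff_space_subspace: "cfun.subspace (matrix_coeff_space G \<sigma>)"
  unfolding matrix_coeff_space_def by (rule cfun.subspace_span)

lemma matrix_coeff_mem:
  "i < rep_dim G \<sigma> \<Longrightarrow> j < rep_dim G \<sigma> \<Longrightarrow>
     on_carrier G (\<lambda>g. \<sigma> g $$ (i, j)) \<in> matrix_coeff_space G \<sigma>"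
  unfolding matrix_coeff_space_def by (rule cfun.span_base) blast

lemma matrix_coeff_space_minimal:
  assumes "cfun.subspace S"
    and "\<And>i j. i < rep_dim G \<sigma> \<Longrightarrow> j < rep_dim G \<sigma> \<Longrightarrow> on_carrier G (\<lambda>g. \<sigma> g $$ (i, j)) \<in> S"
  shows "matrix_coeff_space G \<sigma> \<subseteq> S"
  unfolding matrix_coeff_space_def by (rule cfun.span_minimal[OF _ assms(1)]) (use assms(2) in blast)

text \<open>Translation by \<open>x\<close> sends the coefficient \<open>(i, j)\<close> to a
  combination of the coefficients \<open>(i, k)\<close> of the same row, weighted by column
  \<open>j\<close> of \<open>\<sigma> x\<close>.\<close>

lemma matrix_coeff_space_right_invariant:
  assumes \<sigma>: "matrix_rep G \<sigma>"
  shows "right_invariant (matrix_coeff_space G \<sigma>)"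
  unfolding right_invariant_def
proof (intro ballI)
  fix x f assume x: "x \<in> carrier G" and f: "f \<in> matrix_coeff_space G \<sigma>"
  \<comment> \<open>The functions whose translate lies in the space form a subspace, so it is enough
    to check the generators.\<close>
  let ?S = "{f \<in> L2 G. right_translation G x f \<in> matrix_coeff_space G \<sigma>}"
  have "matrix_coeff_space G \<sigma> \<subseteq> ?S"
  proof (rule matrix_coeff_space_minimal)
    have "\<forall>f\<in>L2 G. \<forall>h\<in>L2 G. right_translation G x (f + h) =
        right_translation G x f + right_translation G x h"
      "\<forall>c. \<forall>f\<in>L2 G. right_translation G x (cscale c f) = cscale c (right_translation G x f)"
      using right_translation_linear by (auto simp: linear_operator_def)
    then show "cfun.subspace ?S"
      using L2_subspace matrix_coeff_space_subspace[of \<sigma>] linear_operator_zero[OF right_translation_linear]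
      unfolding cfun.subspace_def by simp
    fix i j assume ij: "i < rep_dim G \<sigma>" "j < rep_dim G \<sigma>"
    have "right_translation G x (on_carrier G (\<lambda>g. \<sigma> g $$ (i, j))) =
        (\<Sum>k<rep_dim G \<sigma>. cscale (\<sigma> x $$ (k, j)) (on_carrier G (\<lambda>g. \<sigma> g $$ (i, k))))" (is "?l = ?r")
    proof (rule L2_eqI)
      show "?r \<in> L2 G" by (intro L2_sum L2_scale on_carrier_L2)
    qed (simp_all add: right_translation_L2 right_translation_apply sum_fun_apply cscale_def
        on_carrier_def x matrix_rep_mult_entry[OF \<sigma>] ij mult.commute)
    also have "?r \<in> matrix_coeff_space G \<sigma>"
      using matrix_coeff_mem ij by (intro cfun.subspace_sum cfun.subspace_scale matrix_coeff_space_subspace) auto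
    finally show "on_carrier G (\<lambda>g. \<sigma> g $$ (i, j)) \<in> ?S" by (simp add: on_carrier_L2)
  qed
  then show "right_translation G x f \<in> matrix_coeff_space G \<sigma>" using f by blast
qed

text \<open>The coefficient \<open>(0, 0)\<close> equals 1 at the identity. A nonzero space is what
  lets a vanishing trace refute a nonzero eigenvalue.\<close>

lemma matrix_coeff_space_nonzero:
  assumes "matrix_rep G \<sigma>" "0 < rep_dim G \<sigma>"
  shows "matrix_coeff_space G \<sigma> \<noteq> {0}"
proof -
  have "on_carrier G (\<lambda>g. \<sigma> g $$ (0, 0)) \<one> = 1"
    using assms by (simp add: on_carrier_def matrix_rep_def)
  then have "on_carrier G (\<lambda>g. \<sigma> g $$ (0, 0)) \<noteq> 0" by auto
  then show ?thesis using matrix_coeff_mem[OF assms(2,2)] by blast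
qed

text \<open>With \<open>Q\<close> inverse to \<open>P\<close>, the entries of
  \<open>\<tau> g = P * \<sigma> g * Q\<close> are combinations of those of
  \<open>\<sigma> g\<close> with coefficients independent of \<open>g\<close>. This inclusion
  carries eigenspace membership from \<open>\<sigma>\<close> to a chosen representative.\<close>

lemma matrix_coeff_space_equiv:
  assumes "(\<sigma>, \<tau>) \<in> rep_equiv G"
  shows "matrix_coeff_space G \<tau> \<subseteq> matrix_coeff_space G \<sigma>"
proof (rule matrix_coeff_space_minimal[OF matrix_coeff_space_subspace])
  define n where "n = rep_dim G \<sigma>"
  have n: "n = rep_dim G \<tau>" using assms by (simp add: rep_equiv_def n_def)
  obtain P where P: "P \<in> carrier_mat n n" "invertible_mat P"
    and PG: "\<And>g. g \<in> carrier G \<Longrightarrow> P * \<sigma> g = \<tau> g * P"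
    using assms by (auto simp: rep_equiv_def n_def)
  have \<sigma>: "\<And>g. g \<in> carrier G \<Longrightarrow> \<sigma> g \<in> carrier_mat n n"
    and \<tau>: "\<And>g. g \<in> carrier G \<Longrightarrow> \<tau> g \<in> carrier_mat n n"
    using assms n n_def by (auto simp: rep_equiv_def irreducible_rep_def matrix_rep_def)
  obtain Q where PQ: "P * Q = 1\<^sub>m n" and QP: "Q * P = 1\<^sub>m (dim_row Q)"
    using P by (auto simp: invertible_mat_def inverts_mat_def)
  \<comment> \<open>\<open>invertible_mat\<close> leaves the size of \<open>Q\<close> open; it is
    read off from the sizes of the two products.\<close>
  have Q: "Q \<in> carrier_mat n n"
  proof -
    have "dim_col (P * Q) = n" "dim_col (Q * P) = dim_row Q" unfolding PQ QP by auto
    moreover have "dim_col P = n" using P(1) by simp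
    ultimately show ?thesis by (intro carrier_matI) simp_all
  qed
  have \<tau>_eq: "\<tau> g = P * \<sigma> g * Q" if "g \<in> carrier G" for g
    using PG[OF that] P(1) Q PQ \<tau>[OF that] by (simp add: assoc_mult_mat[of _ n n _ n _ n])
  fix i j assume ij: "i < rep_dim G \<tau>" "j < rep_dim G \<tau>"
  have entry: "\<tau> g $$ (i, j) = (\<Sum>k<n. \<Sum>l<n. P $$ (i, k) * Q $$ (l, j) * \<sigma> g $$ (k, l))"
    if g: "g \<in> carrier G" for g
    unfolding \<tau>_eq[OF g] using P(1) Q \<sigma>[OF g] ij n[symmetric]
    by (simp add: scalar_prod_def atLeast0LessThan sum_distrib_right sum_distrib_left mult_ac)
  have "on_carrier G (\<lambda>g. \<tau> g $$ (i, j)) =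
      (\<Sum>k<n. \<Sum>l<n. cscale (P $$ (i, k) * Q $$ (l, j)) (on_carrier G (\<lambda>g. \<sigma> g $$ (k, l))))" (is "?l = ?r")
  proof (rule L2_eqI)
    show "?r \<in> L2 G" by (intro L2_sum L2_scale on_carrier_L2)
    show "?l \<in> L2 G" by (rule on_carrier_L2)
  qed (simp add: sum_fun_apply cscale_def on_carrier_def entry)
  also have "?r \<in> matrix_coeff_space G \<sigma>"
    by (intro cfun.subspace_sum cfun.subspace_scale matrix_coeff_space_subspace matrix_coeff_mem)
      (auto simp: n_def)
  finally show "on_carrier G (\<lambda>g. \<tau> g $$ (i, j)) \<in> matrix_coeff_space G \<sigma>" .
qed

text \<open>By reflexivity \<open>\<sigma>\<close> is itself a unitary member of its class, so the
  \<open>SOME\<close> in \<open>unitary_representative\<close> has a witness and its value lies in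
  that class.\<close>

lemma unitary_representative_mem:
  assumes "irreducible_rep G \<sigma>" "unitary_rep G \<sigma>"
  shows "rep_equiv G `` {\<sigma>} \<in> dual G"
    and "(\<sigma>, unitary_representative G (rep_equiv G `` {\<sigma>})) \<in> rep_equiv G"
proof -
  show "rep_equiv G `` {\<sigma>} \<in> dual G" unfolding dual_def using assms(1) by (auto intro: quotientI)
  have "(\<sigma>, \<sigma>) \<in> rep_equiv G"
    unfolding rep_equiv_def using assms(1)
    by (auto simp: irreducible_rep_def matrix_rep_def intro!: bexI[of _ "1\<^sub>m (rep_dim G \<sigma>)"]
        simp: invertible_mat_def inverts_mat_def square_mat.simps intro: exI[of _ "1\<^sub>m (rep_dim G \<sigma>)"])
  then show "(\<sigma>, unitary_representative G (rep_equiv G `` {\<sigma>})) \<in> rep_equiv G"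
    unfolding unitary_representative_def using assms(2)
    by (rule_tac someI2[of "\<lambda>\<tau>. \<tau> \<in> rep_equiv G `` {\<sigma>} \<and> unitary_rep G \<tau>" \<sigma>]) auto
qed

section \<open>An irreducible unitary representation inside an invariant subspace\<close>

text \<open>Take an orthonormal set of least size among the nonempty ones spanning an invariant
  subspace of \<open>E\<close>; its size plays the role of dimension.\<close>

lemma minimal_invariant_subspace_exists:
  assumes E: "E \<subseteq> L2 G" "cfun.subspace E" "E \<noteq> {0}"
    and inv: "right_invariant E"
  obtains B where "orthonormal G B" "B \<noteq> {}" "cfun.span B \<subseteq> E"
    "right_invariant (cfun.span B)"
    "\<forall>U. cfun.subspace U \<longrightarrow> U \<subseteq> cfun.span B \<longrightarrow> U \<noteq> {0} \<longrightarrow> right_invariant U \<longrightarrow> U = cfun.span B"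
proof -
  define Q where "Q B \<longleftrightarrow> orthonormal G B \<and> B \<noteq> {} \<and> cfun.span B \<subseteq> E \<and>
    right_invariant (cfun.span B)" for B
  have Q_of_subspace: "\<exists>B. Q B \<and> cfun.span B = U" if U: "cfun.subspace U" "U \<subseteq> E" "U \<noteq> {0}" "right_invariant U" for U
  proof -
    obtain B where B: "orthonormal G B" "cfun.span B = U"
      using orthonormal_basis_exists[of U] U E by blast
    moreover have "B \<noteq> {}" using B(2) U(3) cfun.span_empty by metis
    ultimately show ?thesis using U unfolding Q_def by blast
  qed
  obtain B0 where "Q B0" using Q_of_subspace[OF E(2) order_refl E(3) inv] by blast
  then obtain B where B: "Q B" and min: "\<And>B'. Q B' \<Longrightarrow> card B \<le> card B'"
    using ex_has_least_nat[of Q B0 card] by blast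
  have on: "orthonormal G B" and BE: "cfun.span B \<subseteq> E" using B by (auto simp: Q_def)
  show thesis
  proof
    show "orthonormal G B" "B \<noteq> {}" "cfun.span B \<subseteq> E" "right_invariant (cfun.span B)"
      using B by (auto simp: Q_def)
    show "\<forall>U. cfun.subspace U \<longrightarrow> U \<subseteq> cfun.span B \<longrightarrow> U \<noteq> {0} \<longrightarrow> right_invariant U \<longrightarrow> U = cfun.span B"
    proof (intro allI impI)
      fix U assume U: "cfun.subspace U" "U \<subseteq> cfun.span B" "U \<noteq> {0}" "right_invariant U"
      obtain B' where B': "Q B'" "cfun.span B' = U"
        using Q_of_subspace[OF U(1) _ U(3,4)] U(2) BE by blast
      have on': "orthonormal G B'" "B' \<subseteq> cfun.span B"
        using B' U(2) cfun.span_superset by (auto simp: Q_def)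
      \<comment> \<open>Otherwise a unit vector of \<open>span B\<close> orthogonal to a basis
        \<open>B'\<close> of \<open>U\<close> makes \<open>insert e B'\<close> independent in
        \<open>span B\<close>, so \<open>B'\<close> would be smaller than \<open>B\<close>.\<close>
      show "U = cfun.span B"
      proof (rule ccontr)
        assume "U \<noteq> cfun.span B"
        then obtain e where e: "e \<in> cfun.span B" "inner_L2 G e e = 1" "\<forall>b\<in>B'. inner_L2 G b e = 0"
          using orthogonal_unit_vector_exists[of "cfun.span B" B'] B'(2) on' BE E(1)
            cfun.subspace_span by blast
        have eL2: "e \<in> L2 G" using e(1) BE E(1) by blast
        have "finite B'" "finite B" using on on'(1) by (auto simp: orthonormal_def)
        note ins = orthonormal_insert[OF on'(1) eL2 e(2,3)]
        have "card (insert e B') \<le> card B"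
          using cfun.independent_span_bound[OF \<open>finite B\<close> orthonormal_independent[OF ins(1)]] e(1) on'(2)
          by blast
        then show False using min[OF B'(1)] ins(2) \<open>finite B'\<close> by simp
      qed
    qed
  qed
qed

text \<open>Take the matrices of right translations on a minimal invariant subspace in an
  orthonormal basis \<open>b\<close>: they are unitary because right translations preserve the inner
  product, and irreducible by minimality. The basis is returned too, since its vectors lie in
  \<open>E\<close> and give the entries of \<open>\<sigma>\<close> as inner products.\<close>

lemma irreducible_rep_exists:
  assumes E: "E \<subseteq> L2 G" "cfun.subspace E" "E \<noteq> {0}"
    and inv: "right_invariant E"
  obtains \<sigma> b where "irreducible_rep G \<sigma>" "unitary_rep G \<sigma>"
    "\<And>j. j < rep_dim G \<sigma> \<Longrightarrow> b j \<in> E"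
    "\<And>i j. i < rep_dim G \<sigma> \<Longrightarrow> j < rep_dim G \<sigma> \<Longrightarrow> inner_L2 G (b i) (b j) = (if i = j then 1 else 0)"
    "\<And>g i j. g \<in> carrier G \<Longrightarrow> i < rep_dim G \<sigma> \<Longrightarrow> j < rep_dim G \<sigma> \<Longrightarrow>
      inner_L2 G (b i) (right_translation G g (b j)) = \<sigma> g $$ (i, j)"
proof -
  let ?R = "right_translation G"
  obtain B where B: "orthonormal G B" "B \<noteq> {}" "cfun.span B \<subseteq> E"
    and Binv': "right_invariant (cfun.span B)"
    and Bmin: "\<forall>U. cfun.subspace U \<longrightarrow> U \<subseteq> cfun.span B \<longrightarrow> U \<noteq> {0} \<longrightarrow> right_invariant U \<longrightarrow> U = cfun.span B"
    by (rule minimal_invariant_subspace_exists[OF E inv])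
  have Binv: "?R x f \<in> cfun.span B" if "x \<in> carrier G" "f \<in> cfun.span B" for x f
    using Binv' that by (simp add: right_invariant_def)
  define n where "n = card B"
  obtain b where b: "bij_betw b {..<n} B"
    and orth: "\<And>i j. i < n \<Longrightarrow> j < n \<Longrightarrow> inner_L2 G (b i) (b j) = (if i = j then 1 else 0)"
    and exp: "\<And>f. f \<in> cfun.span B \<Longrightarrow> f = (\<Sum>i<n. cscale (inner_L2 G (b i) f) (b i))"
    by (rule orthonormal_enumeration[OF B(1), folded n_def]) blast
  have "0 < n" using B by (auto simp: n_def orthonormal_def card_gt_0_iff)
  have bspan: "b i \<in> cfun.span B" if "i < n" for i
    using b that by (auto simp: bij_betw_def intro: cfun.span_base)
  have spanL2: "cfun.span B \<subseteq> L2 G" using B(3) E(1) by blast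
  define \<sigma> where "\<sigma> g = mat n n (\<lambda>(i, j). inner_L2 G (b i) (?R g (b j)))" for g
  have dim: "rep_dim G \<sigma> = n" by (simp add: rep_dim_def \<sigma>_def)
  have entry: "\<sigma> g $$ (i, j) = inner_L2 G (b i) (?R g (b j))" if "i < n" "j < n" for g i j
    using that by (simp add: \<sigma>_def)
  have carr: "\<sigma> g \<in> carrier_mat n n" for g by (simp add: \<sigma>_def)
  \<comment> \<open>Column \<open>j\<close> of \<open>\<sigma> g\<close> holds the coordinates of
    the translate of \<open>b j\<close>.\<close>
  have Rb: "?R g (b j) = (\<Sum>i<n. cscale (\<sigma> g $$ (i, j)) (b i))" if "g \<in> carrier G" "j < n" for g j
    using exp[OF Binv[OF that(1) bspan[OF that(2)]]] that(2) by (simp add: entry)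
  have mult: "\<sigma> (g \<otimes> h) = \<sigma> g * \<sigma> h" if gh: "g \<in> carrier G" "h \<in> carrier G" for g h
  proof (rule eq_matI)
    fix i j assume "i < dim_row (\<sigma> g * \<sigma> h)" "j < dim_col (\<sigma> g * \<sigma> h)"
    then have ij: "i < n" "j < n" using carr[of g] carr[of h] by auto
    have "?R (g \<otimes> h) (b j) = ?R g (\<Sum>k<n. cscale (\<sigma> h $$ (k, j)) (b k))"
      using right_translation_mult[OF gh] Rb[OF gh(2) ij(2)] by metis
    also have "\<dots> = (\<Sum>k<n. cscale (\<sigma> h $$ (k, j)) (?R g (b k)))"
      using bspan spanL2 by (intro linear_operator_sum[OF right_translation_linear]) auto
    finally have "\<sigma> (g \<otimes> h) $$ (i, j) = (\<Sum>k<n. \<sigma> h $$ (k, j) * \<sigma> g $$ (i, k))"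
      using ij by (simp add: entry inner_sum_right inner_scale_right)
    then show "\<sigma> (g \<otimes> h) $$ (i, j) = (\<sigma> g * \<sigma> h) $$ (i, j)"
      using ij carr[of g] carr[of h] by (simp add: scalar_prod_def atLeast0LessThan mult.commute)
  qed (use carr[of g] carr[of h] carr[of "g \<otimes> h"] in auto)
  have rep: "matrix_rep G \<sigma>"
    unfolding matrix_rep_def dim
  proof (intro conjI ballI)
    show "\<sigma> \<one> = 1\<^sub>m n"
    proof (rule eq_matI)
      fix i j assume "i < dim_row (1\<^sub>m n :: complex mat)" "j < dim_col (1\<^sub>m n :: complex mat)"
      then have ij: "i < n" "j < n" by auto
      then have "?R \<one> (b j) = b j" using right_translation_one bspan spanL2 by blast
      then show "\<sigma> \<one> $$ (i, j) = 1\<^sub>m n $$ (i, j)" using ij by (simp add: entry orth)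
    qed (use carr in auto)
  qed (use carr mult in auto)
  have unitary: "unitary_rep G \<sigma>"
    unfolding unitary_rep_def dim
  proof (intro conjI ballI rep eq_matI)
    fix g i j assume g: "g \<in> carrier G"
      and "i < dim_row (1\<^sub>m n :: complex mat)" "j < dim_col (1\<^sub>m n :: complex mat)"
    then have ij: "i < n" "j < n" by auto
    \<comment> \<open>The Gram matrix of the translated basis is the adjoint of
      \<open>\<sigma> g\<close> times \<open>\<sigma> g\<close>.\<close>
    have "inner_L2 G (?R g (b i)) (?R g (b j)) = (\<Sum>k<n. cnj (\<sigma> g $$ (k, i)) * \<sigma> g $$ (k, j))"
      by (subst Rb[OF g ij(1)]) (simp add: inner_sum_left inner_scale_left entry ij)
    then have "(\<Sum>k<n. cnj (\<sigma> g $$ (k, i)) * \<sigma> g $$ (k, j)) = (if i = j then 1 else 0)"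
      using inner_right_translation[OF g] orth ij by simp
    then show "(mat_adjoint (\<sigma> g) * \<sigma> g) $$ (i, j) = 1\<^sub>m n $$ (i, j)"
      using ij carr[of g]
      by (simp add: mat_adjoint_def mat_of_rows_index scalar_prod_def atLeast0LessThan)
  qed (use carr in \<open>auto simp: mat_adjoint_def\<close>)
  have irr: "irreducible_rep G \<sigma>"
    unfolding irreducible_rep_def dim
  proof (intro conjI allI impI rep \<open>0 < n\<close>)
    fix W assume W: "VectorSpace.subspace class_ring W (module_vec TYPE(complex) n) \<and>
      (\<forall>g\<in>carrier G. \<forall>w\<in>W. \<sigma> g *\<^sub>v w \<in> W)"
    then have Wc: "W \<subseteq> carrier_vec n" "\<And>v w. v \<in> W \<Longrightarrow> w \<in> W \<Longrightarrow> v + w \<in> W" "0\<^sub>v n \<in> W"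
      "\<And>c v. v \<in> W \<Longrightarrow> c \<cdot>\<^sub>v v \<in> W"
      by (auto simp: VectorSpace.subspace_def submodule_def module_vec_simps class_ring_simps)
    \<comment> \<open>The coordinate isomorphism onto \<open>span B\<close>; by \<open>Rp\<close> it
      intertwines \<open>\<sigma> g\<close> with right translation, so the image of \<open>W\<close>
      is a right-invariant subspace.\<close>
    define p where "p v = (\<Sum>i<n. cscale (v $ i) (b i))" for v
    have coord: "inner_L2 G (b i) (p v) = v $ i" if "i < n" for i v
    proof -
      have "inner_L2 G (b i) (p v) = (\<Sum>j<n. if j = i then v $ i else 0)"
        unfolding p_def inner_sum_right inner_scale_right
        using that orth by (intro sum.cong refl) auto
      then show ?thesis using that by simp
    qed
    have p_inj: "v = w" if "p v = p w" "v \<in> carrier_vec n" "w \<in> carrier_vec n" for v w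
      using that coord by (intro eq_vecI) (auto, metis)
    have p_span: "p v \<in> cfun.span B" for v
      unfolding p_def using bspan by (intro cfun.span_sum cfun.span_scale) auto
    have Rp: "?R g (p v) = p (\<sigma> g *\<^sub>v v)" if g: "g \<in> carrier G" and v: "v \<in> carrier_vec n" for g v
    proof -
      have "?R g (p v) = (\<Sum>j<n. cscale (v $ j) (?R g (b j)))"
        unfolding p_def using bspan spanL2 by (intro linear_operator_sum[OF right_translation_linear]) auto
      also have "\<dots> = (\<Sum>j<n. \<Sum>i<n. cscale (\<sigma> g $$ (i, j) * v $ j) (b i))"
        using g by (intro sum.cong refl) (simp add: Rb cfun.scale_sum_right mult.commute)
      also have "\<dots> = (\<Sum>i<n. \<Sum>j<n. cscale (\<sigma> g $$ (i, j) * v $ j) (b i))" by (rule sum.swap)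
      also have "\<dots> = p (\<sigma> g *\<^sub>v v)"
        unfolding p_def using v carr[of g]
        by (intro sum.cong refl)
          (simp add: scalar_prod_def atLeast0LessThan cfun.scale_sum_left)
      finally show ?thesis .
    qed
    have "p (0\<^sub>v n) = 0" by (simp add: p_def)
    show "W = {0\<^sub>v n} \<or> W = carrier_vec n"
    \<comment> \<open>Injectivity of \<open>p\<close> settles a zero image; by minimality any other
      image is all of \<open>span B\<close>.\<close>
    proof (cases "p ` W = {0}")
      case True
      then have "v = 0\<^sub>v n" if "v \<in> W" for v
        using that Wc(1) \<open>p (0\<^sub>v n) = 0\<close> by (intro p_inj) auto
      then show ?thesis using Wc(3) by blast
    next
      case False
      have "p ` W = cfun.span B"
      proof (rule Bmin[rule_format])
        show "cfun.subspace (p ` W)"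
          unfolding cfun.subspace_def
        proof (intro conjI ballI allI)
          show "0 \<in> p ` W" using Wc(3) \<open>p (0\<^sub>v n) = 0\<close> by (metis imageI)
        next
          fix f h assume "f \<in> p ` W" "h \<in> p ` W"
          then obtain v w where vw: "v \<in> W" "w \<in> W" "f = p v" "h = p w" by blast
          then have "w \<in> carrier_vec n" using Wc(1) by blast
          then have "p (v + w) = f + h"
            unfolding vw p_def sum.distrib[symmetric]
            by (intro sum.cong refl) (simp add: cfun.scale_left_distrib)
          then show "f + h \<in> p ` W" using Wc(2)[OF vw(1,2)] by (metis imageI)
        next
          fix c f assume "f \<in> p ` W"
          then obtain v where v: "v \<in> W" "f = p v" by blast
          then have "v \<in> carrier_vec n" using Wc(1) by blast
          then have "p (c \<cdot>\<^sub>v v) = cscale c f"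
            unfolding v p_def cfun.scale_sum_right by (intro sum.cong refl) simp
          then show "cscale c f \<in> p ` W" using Wc(4)[OF v(1)] by (metis imageI)
        qed
        show "p ` W \<subseteq> cfun.span B" using p_span by blast
        show "p ` W \<noteq> {0}" by fact
        show "right_invariant (p ` W)"
          using W Wc(1) by (auto simp: right_invariant_def Rp subset_iff)
      qed
      moreover have "v \<in> W" if v: "v \<in> carrier_vec n" "p v \<in> p ` W" for v
      proof -
        obtain w where w: "w \<in> W" "p v = p w" using v(2) by blast
        then have "v = w" using v(1) Wc(1) by (intro p_inj) auto
        then show ?thesis using w(1) by simp
      qed
      ultimately show ?thesis using Wc(1) p_span by blast
    qed
  qed
  show thesis
    by (rule that[OF irr unitary, unfolded dim]) (use B(3) bspan orth entry in auto)
qed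

section \<open>Class-function kernels with vanishing traces\<close>

text \<open>The hypothesis \<open>trace\<close> is phrased through orthonormal bases rather than
  \<open>omega\<close>, so that it can be verified for a difference of kernels by linearity. Its
  premises hand over what is known of the basis: right invariance for the conjugation average,
  non-emptiness for cancelling \<open>card B\<close>.\<close>

lemma conv_operator_eq_zero:
  assumes herm: "\<And>x. x \<in> carrier G \<Longrightarrow> \<delta> (inv x) = cnj (\<delta> x)"
    and conj: "\<And>a x. a \<in> carrier G \<Longrightarrow> x \<in> carrier G \<Longrightarrow> \<delta> (a \<otimes> x \<otimes> inv a) = \<delta> x"
    and trace: "\<And>c B. c \<in> dual G \<Longrightarrow> orthonormal G B \<Longrightarrow> right_invariant (cfun.span B) \<Longrightarrow>
      cfun.span B = matrix_coeff_space G (unitary_representative G c) \<Longrightarrow> B \<noteq> {} \<Longrightarrow>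
      operator_trace G B (conv_operator G \<delta>) = 0"
    and f: "f \<in> L2 G"
  shows "conv_operator G \<delta> f = 0"
proof -
  let ?T = "conv_operator G \<delta>"
  have T: "hermitian_operator G ?T" by (rule conv_operator_hermitian) (rule herm)
  obtain B where B: "orthonormal G B" "cfun.span B = L2 G"
    and ev: "\<And>e. e \<in> B \<Longrightarrow> ?T e = cscale (inner_L2 G e (?T e)) e"
    using spectral_theorem[OF T order_refl L2_subspace conv_operator_L2]
    by metis
  have BL2: "B \<subseteq> L2 G" using B(1) by (simp add: orthonormal_def)
  have "inner_L2 G e (?T e) = 0" if e: "e \<in> B" for e
  proof (rule ccontr)
    define l where "l = inner_L2 G e (?T e)"
    assume "inner_L2 G e (?T e) \<noteq> 0"
    then have "l \<noteq> 0" by (simp add: l_def)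
    \<comment> \<open>The eigenspace of \<open>l\<close> in all of \<open>L2 G\<close>; it is
      right-invariant because \<open>\<delta>\<close> is a class function, so it carries an
      irreducible representation.\<close>
    define E where "E = {f \<in> L2 G. ?T f = cscale l f}"
    have "?T e = cscale l e" unfolding l_def by (rule ev[OF e])
    moreover have "e \<noteq> 0" using B(1) e by (metis inner_zero_left orthonormal_def zero_neq_one)
    ultimately have "E \<noteq> {0}" using e BL2 by (auto simp: E_def)
    have subE: "cfun.subspace E"
      unfolding E_def
      using L2_subspace conv_operator_linear[of \<delta>] linear_operator_zero[OF conv_operator_linear]
      by (simp add: cfun.subspace_def linear_operator_def cfun.scale_right_distrib mult.commute)
    have invE: "right_invariant E"
      unfolding right_invariant_def
    proof (intro ballI)
      fix x h assume x: "x \<in> carrier G" and h: "h \<in> E"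
      have "?T (right_translation G x h) = right_translation G x (?T h)"
        by (rule conv_operator_right_translation) (use x conj in auto)
      also have "\<dots> = right_translation G x (cscale l h)" using h by (simp add: E_def)
      also have "\<dots> = cscale l (right_translation G x h)"
        using right_translation_linear h by (auto simp: linear_operator_def E_def)
      finally show "right_translation G x h \<in> E" by (simp add: E_def right_translation_L2)
    qed
    obtain \<sigma> b where \<sigma>: "irreducible_rep G \<sigma>" "unitary_rep G \<sigma>"
      and bE: "\<And>j. j < rep_dim G \<sigma> \<Longrightarrow> b j \<in> E"
      and orth: "\<And>i j. i < rep_dim G \<sigma> \<Longrightarrow> j < rep_dim G \<sigma> \<Longrightarrow>
        inner_L2 G (b i) (b j) = (if i = j then 1 else 0)"
      and entry: "\<And>g i j. g \<in> carrier G \<Longrightarrow> i < rep_dim G \<sigma> \<Longrightarrow> j < rep_dim G \<sigma> \<Longrightarrow>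
        inner_L2 G (b i) (right_translation G g (b j)) = \<sigma> g $$ (i, j)"
      by (rule irreducible_rep_exists[of E]) (use subE invE \<open>E \<noteq> {0}\<close> in \<open>auto simp: E_def\<close>)
    define n where "n = rep_dim G \<sigma>"
    have rep: "matrix_rep G \<sigma>" using \<sigma>(1) by (simp add: irreducible_rep_def)
    txt \<open>The basis of \<open>E\<close> carried by \<open>\<sigma>\<close> consists of eigenvectors, which replaces Schur's lemma here.\<close>
    have M: "(\<Sum>x\<in>carrier G. \<delta> x * \<sigma> x $$ (i, j)) = (if i = j then l else 0)" if ij: "i < n" "j < n" for i j
    proof -
      have "(\<Sum>x\<in>carrier G. \<delta> x * \<sigma> x $$ (i, j)) = inner_L2 G (b i) (?T (b j))"
        unfolding conv_operator_eq_sum inner_sum_right inner_scale_right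
        using ij by (simp add: entry n_def)
      also have "\<dots> = l * inner_L2 G (b i) (b j)"
        using bE ij by (simp add: E_def n_def inner_scale_right)
      finally show ?thesis using orth ij by (simp add: n_def)
    qed
    \<comment> \<open>The sum of \<open>\<delta> x\<close> times
      \<open>\<sigma> (g \<otimes> x)\<close> factors as \<open>\<sigma> g\<close> times the scalar
      matrix from \<open>M\<close>, so every coefficient of \<open>\<sigma>\<close> is an
      eigenfunction for \<open>l\<close>.\<close>
    have "matrix_coeff_space G \<sigma> \<subseteq> E"
    proof (rule matrix_coeff_space_minimal[OF subE])
      fix i j assume "i < rep_dim G \<sigma>" "j < rep_dim G \<sigma>"
      then have ij: "i < n" "j < n" by (simp_all add: n_def)
      have "?T (on_carrier G (\<lambda>g. \<sigma> g $$ (i, j))) = cscale l (on_carrier G (\<lambda>g. \<sigma> g $$ (i, j)))"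
      proof (rule L2_eqI)
        fix g assume g: "g \<in> carrier G"
        have "?T (on_carrier G (\<lambda>g. \<sigma> g $$ (i, j))) g =
            (\<Sum>x\<in>carrier G. \<Sum>k<n. \<sigma> g $$ (i, k) * (\<delta> x * \<sigma> x $$ (k, j)))"
          using g ij matrix_rep_mult_entry[OF rep g]
          by (simp add: conv_operator_apply on_carrier_def n_def sum_distrib_left mult_ac)
        also have "\<dots> = (\<Sum>k<n. \<Sum>x\<in>carrier G. \<sigma> g $$ (i, k) * (\<delta> x * \<sigma> x $$ (k, j)))"
          by (rule sum.swap)
        also have "\<dots> = (\<Sum>k<n. if k = j then l * \<sigma> g $$ (i, j) else 0)"
          using ij by (intro sum.cong refl) (simp add: M flip: sum_distrib_left)
        also have "\<dots> = cscale l (on_carrier G (\<lambda>g. \<sigma> g $$ (i, j))) g"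
          using g ij by (simp add: cscale_def on_carrier_def)
        finally show "?T (on_carrier G (\<lambda>g. \<sigma> g $$ (i, j))) g =
          cscale l (on_carrier G (\<lambda>g. \<sigma> g $$ (i, j))) g" .
      qed (intro conv_operator_L2 L2_scale on_carrier_L2)+
      then show "on_carrier G (\<lambda>g. \<sigma> g $$ (i, j)) \<in> E"
        by (simp add: E_def on_carrier_L2)
    qed
    \<comment> \<open>\<open>trace\<close> speaks of the chosen representative \<open>\<tau>\<close>
      of the class, which may differ from \<open>\<sigma>\<close>; equivalence carries the action by
      \<open>l\<close> over.\<close>
    moreover define c where "c = rep_equiv G `` {\<sigma>}"
    define \<tau> where "\<tau> = unitary_representative G c"
    have c: "c \<in> dual G" "(\<sigma>, \<tau>) \<in> rep_equiv G"
      unfolding c_def \<tau>_def by (rule unitary_representative_mem[OF \<sigma>])+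
    then have irr\<tau>: "matrix_rep G \<tau>" "0 < rep_dim G \<tau>"
      by (auto simp: rep_equiv_def irreducible_rep_def)
    ultimately have act: "?T f = cscale l f" if "f \<in> matrix_coeff_space G \<tau>" for f
      using matrix_coeff_space_equiv[OF c(2)] that by (auto simp: E_def)
    obtain C where C: "orthonormal G C" "cfun.span C = matrix_coeff_space G \<tau>"
      using orthonormal_basis_exists[OF matrix_coeff_space_L2 matrix_coeff_space_subspace] .
    have "C \<noteq> {}" using matrix_coeff_space_nonzero[OF irr\<tau>] C(2) cfun.span_empty by metis
    have "right_invariant (cfun.span C)"
      unfolding C(2) by (rule matrix_coeff_space_right_invariant[OF irr\<tau>(1)])
    then have "operator_trace G C ?T = 0"
      using trace[OF c(1) C(1)] C(2) \<open>C \<noteq> {}\<close> by (simp add: \<tau>_def)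
    \<comment> \<open>On the coefficient space the operator is the scalar \<open>l\<close>, so its
      trace is \<open>l\<close> times the size of \<open>C\<close>, which is nonzero.\<close>
    moreover have "operator_trace G C ?T = (\<Sum>e\<in>C. l)"
      unfolding operator_trace_def
    proof (intro sum.cong refl)
      fix e assume e: "e \<in> C"
      then have "?T e = cscale l e" using act C(2) cfun.span_base by metis
      then show "inner_L2 G e (?T e) = l" using C(1) e by (simp add: orthonormal_def inner_scale_right)
    qed
    ultimately show False using \<open>l \<noteq> 0\<close> \<open>C \<noteq> {}\<close> C(1) by (auto simp: orthonormal_def)
  qed
  \<comment> \<open>All eigenvalues vanish, so the operator kills an orthonormal basis of
    \<open>L2 G\<close>.\<close>
  then have T0: "?T e = 0" if "e \<in> B" for e using ev[OF that] that by (metis cfun.scale_zero_left)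
  have "?T f = ?T (\<Sum>e\<in>B. cscale (inner_L2 G e f) e)"
    by (rule arg_cong[OF orthonormal_expansion[OF B(1)]]) (simp add: B(2) f)
  also have "\<dots> = (\<Sum>e\<in>B. cscale (inner_L2 G e f) (?T e))"
    using BL2 by (intro linear_operator_sum[OF conv_operator_linear]) blast
  also have "\<dots> = 0" by (intro sum.neutral) (simp add: T0)
  finally show ?thesis .
qed

section \<open>Cayley graph Laplacians as convolution operators\<close>

text \<open>The convolution kernel of \<open>class_laplacian\<close>: the point mass at the identity
  minus the uniform distribution on \<open>K\<close>.\<close>

definition class_kernel :: "'a set \<Rightarrow> 'a \<Rightarrow> complex" where
  "class_kernel K x = (if x = \<one> then 1 else 0) - (if x \<in> K then 1 / of_nat (card K) else 0)"

definition weighted_class_kernel :: "('a set \<Rightarrow> real) \<Rightarrow> 'a \<Rightarrow> complex" where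
  "weighted_class_kernel \<alpha> x = (\<Sum>K\<in>sym_classes G. of_real (\<alpha> K) * class_kernel K x)"

text \<open>Inversion exchanges the two halves of \<open>K\<close>, and conjugation commutes with
  inversion. The first closure property makes the kernels Hermitian, the second makes them class
  functions.\<close>

lemma sym_class_closed:
  assumes "K \<in> sym_classes G"
  shows "K \<subseteq> carrier G" "K \<noteq> {}"
    and "\<And>x. x \<in> carrier G \<Longrightarrow> inv x \<in> K \<longleftrightarrow> x \<in> K"
    and "\<And>a x. a \<in> carrier G \<Longrightarrow> x \<in> carrier G \<Longrightarrow> a \<otimes> x \<otimes> inv a \<in> K \<longleftrightarrow> x \<in> K"
proof -
  obtain y where y: "y \<in> carrier G"
    and K: "K = (\<lambda>a. a \<otimes> y \<otimes> inv a) ` carrier G \<union> m_inv G ` (\<lambda>a. a \<otimes> y \<otimes> inv a) ` carrier G"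
    using assms by (auto simp: sym_classes_def conjugacy_classes_def orbits_def orbit_def SET_INV_def
        UNION_singleton_eq_range Setcompr_eq_image)
  then show sub: "K \<subseteq> carrier G" and "K \<noteq> {}" by auto
  have inv: "inv x \<in> K" if "x \<in> K" for x
    using that y unfolding K by auto
  then show "inv x \<in> K \<longleftrightarrow> x \<in> K" if "x \<in> carrier G" for x using that by (metis inv_inv)
  have conj: "a \<otimes> x \<otimes> inv a \<in> K" if a: "a \<in> carrier G" and x: "x \<in> K" for a x
  proof -
    have *: "a \<otimes> (b \<otimes> y \<otimes> inv b) \<otimes> inv a \<in> (\<lambda>a. a \<otimes> y \<otimes> inv a) ` carrier G"
      if b: "b \<in> carrier G" for b
      by (rule image_eqI[of _ _ "a \<otimes> b"]) (use a b y in \<open>simp_all add: m_assoc inv_mult_group\<close>)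
    have **: "a \<otimes> inv (b \<otimes> y \<otimes> inv b) \<otimes> inv a = inv (a \<otimes> (b \<otimes> y \<otimes> inv b) \<otimes> inv a)"
      if b: "b \<in> carrier G" for b
      using a b y by (simp add: m_assoc inv_mult_group)
    show ?thesis using x * unfolding K by (auto simp: **)
  qed
  show "a \<otimes> x \<otimes> inv a \<in> K \<longleftrightarrow> x \<in> K" if "a \<in> carrier G" "x \<in> carrier G" for a x
  proof
    assume "a \<otimes> x \<otimes> inv a \<in> K"
    then have "inv a \<otimes> (a \<otimes> x \<otimes> inv a) \<otimes> inv (inv a) \<in> K" using conj that by blast
    moreover have "inv a \<otimes> (a \<otimes> x \<otimes> inv a) \<otimes> inv (inv a) = x"
      using that by (simp add: m_assoc) (simp add: m_assoc[symmetric])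
    ultimately show "x \<in> K" by simp
  qed (use conj that in blast)
qed

lemma sym_class_card: "K \<in> sym_classes G \<Longrightarrow> finite K \<and> card K \<noteq> 0"
  using sym_class_closed(1,2) finite_carrier by (metis card_0_eq finite_subset)

lemma class_kernel_inv:
  "K \<in> sym_classes G \<Longrightarrow> x \<in> carrier G \<Longrightarrow> class_kernel K (inv x) = cnj (class_kernel K x)"
  by (simp add: class_kernel_def sym_class_closed(3) inv_eq_1_iff)

lemma class_kernel_conj:
  assumes "K \<in> sym_classes G" "a \<in> carrier G" "x \<in> carrier G"
  shows "class_kernel K (a \<otimes> x \<otimes> inv a) = class_kernel K x"
proof -
  have "a \<otimes> x \<otimes> inv a = \<one> \<longleftrightarrow> x = \<one>"
  proof
    assume "a \<otimes> x \<otimes> inv a = \<one>"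
    then have "inv a \<otimes> (a \<otimes> x \<otimes> inv a) \<otimes> a = \<one>" using assms(2) by simp
    moreover have "inv a \<otimes> (a \<otimes> x \<otimes> inv a) \<otimes> a = x"
      using assms(2,3) by (simp add: m_assoc) (simp add: m_assoc[symmetric])
    ultimately show "x = \<one>" by simp
  qed (use assms(2) in simp)
  then show ?thesis using assms by (simp add: class_kernel_def sym_class_closed(4))
qed

lemma conv_class_kernel_apply:
  assumes K: "K \<in> sym_classes G" and g: "g \<in> carrier G"
  shows "conv_operator G (class_kernel K) f g = f g - (1 / of_nat (card K)) * (\<Sum>s\<in>K. f (g \<otimes> s))"
proof -
  have "(\<Sum>x\<in>carrier G. (if x \<in> K then 1 / of_nat (card K) else 0) * f (g \<otimes> x)) =
      (\<Sum>x\<in>carrier G. if x \<in> K then 1 / of_nat (card K) * f (g \<otimes> x) else 0)"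
    by (intro sum.cong) auto
  also have "\<dots> = (\<Sum>x\<in>carrier G \<inter> K. 1 / of_nat (card K) * f (g \<otimes> x))"
    by (rule sum.inter_restrict[OF finite_carrier, symmetric])
  also have "carrier G \<inter> K = K" using sym_class_closed(1)[OF K] by blast
  finally have 1: "(\<Sum>x\<in>carrier G. (if x \<in> K then 1 / of_nat (card K) else 0) * f (g \<otimes> x)) =
      1 / of_nat (card K) * (\<Sum>s\<in>K. f (g \<otimes> s))"
    by (simp add: sum_distrib_left)
  have "(\<Sum>x\<in>carrier G. (if x = \<one> then 1 else 0) * f (g \<otimes> x)) =
      (\<Sum>x\<in>carrier G. if x = \<one> then f g else 0)"
    using g by (intro sum.cong) auto
  then have 2: "(\<Sum>x\<in>carrier G. (if x = \<one> then 1 else 0) * f (g \<otimes> x)) = f g"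
    using finite_carrier by simp
  show ?thesis
    unfolding conv_operator_apply[OF g] class_kernel_def left_diff_distrib sum_subtractf 1 2 ..
qed

text \<open>\<open>class_laplacian\<close> subtracts from \<open>f\<close> itself, without cutting
  it off, so \<open>f \<in> L2 G\<close> gives agreement outside the carrier.\<close>

lemma class_laplacian_eq_conv:
  assumes "K \<in> sym_classes G" "f \<in> L2 G"
  shows "class_laplacian G K f = conv_operator G (class_kernel K) f"
proof (rule L2_eqI)
  show "class_laplacian G K f \<in> L2 G"
    unfolding class_laplacian_def class_average_def by (intro L2_diff on_carrier_L2 assms(2))
qed (simp_all add: conv_operator_L2 conv_class_kernel_apply assms(1) class_laplacian_def
    class_average_def on_carrier_def)

lemma conv_weighted_class_kernel:
  "conv_operator G (weighted_class_kernel \<alpha>) f =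
     (\<Sum>K\<in>sym_classes G. cscale (of_real (\<alpha> K)) (conv_operator G (class_kernel K) f))"
proof (rule L2_eqI)
  show "(\<Sum>K\<in>sym_classes G. cscale (of_real (\<alpha> K)) (conv_operator G (class_kernel K) f)) \<in> L2 G"
    by (intro L2_sum L2_scale conv_operator_L2)
  fix g assume "g \<in> carrier G"
  then show "conv_operator G (weighted_class_kernel \<alpha>) f g =
      (\<Sum>K\<in>sym_classes G. cscale (of_real (\<alpha> K)) (conv_operator G (class_kernel K) f)) g"
    by (simp add: conv_operator_apply sum_fun_apply cscale_def weighted_class_kernel_def
        sum_distrib_left sum_distrib_right mult.assoc sum.swap[of _ "sym_classes G"])
qed (rule conv_operator_L2)

text \<open>Both sides are cut off to 0 outside the carrier for arbitrary \<open>f\<close>, so only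
  values at group elements have to be compared.\<close>

lemma conv_weighted_class_kernel_eq_laplacian:
  "conv_operator G (weighted_class_kernel \<alpha>) f =
     graph_laplacian (cayley_graph G) (cayley_weight \<alpha>) f"
proof (rule L2_eqI)
  show "graph_laplacian (cayley_graph G) (cayley_weight \<alpha>) f \<in> L2 G"
    by (simp add: graph_laplacian_def cayley_graph_def L2_def)
  fix g assume g: "g \<in> carrier G"
  show "conv_operator G (weighted_class_kernel \<alpha>) f g =
      graph_laplacian (cayley_graph G) (cayley_weight \<alpha>) f g"
    unfolding conv_weighted_class_kernel sum_fun_apply
      cayley_laplacian_formula[OF is_group finite_carrier g]
  proof (rule sum.cong[OF refl])
    fix K assume K: "K \<in> sym_classes G"
    \<comment> \<open>\<open>K\<close> is finite and nonempty, so \<open>card K\<close> copies of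
      \<open>f g\<close> divided by \<open>card K\<close> give \<open>f g\<close> once.\<close>
    show "cscale (of_real (\<alpha> K)) (conv_operator G (class_kernel K) f) g =
        of_real (\<alpha> K / real (card K)) * (\<Sum>s\<in>K. f g - f (g \<otimes> s))"
      unfolding cscale_def conv_class_kernel_apply[OF K g]
      using sym_class_card[OF K] sym_class_closed(2)[OF K]
      by (simp add: sum_subtractf field_simps)
  qed
qed (rule conv_operator_L2)

section \<open>Positivity of the class Laplacians\<close>

text \<open>A Dirichlet form: the average over \<open>s \<in> K\<close> of terms whose real part is
  half the squared norm of \<open>f - ?R s f\<close>.\<close>

lemma conv_class_kernel_nonneg:
  assumes K: "K \<in> sym_classes G" and f: "f \<in> L2 G"
  shows "0 \<le> Re (inner_L2 G f (conv_operator G (class_kernel K) f))"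
proof -
  let ?R = "right_translation G"
  have eq: "conv_operator G (class_kernel K) f = (\<Sum>s\<in>K. cscale (of_real (1 / card K)) (f - ?R s f))"
  proof (rule L2_eqI)
    show "(\<Sum>s\<in>K. cscale (of_real (1 / card K)) (f - ?R s f)) \<in> L2 G"
      by (intro L2_sum L2_scale L2_diff f right_translation_L2)
    fix g assume g: "g \<in> carrier G"
    then show "conv_operator G (class_kernel K) f g =
        (\<Sum>s\<in>K. cscale (of_real (1 / card K)) (f - ?R s f)) g"
      using sym_class_card[OF K] sym_class_closed(2)[OF K]
      by (simp add: conv_class_kernel_apply[OF K] sum_fun_apply cscale_def right_translation_apply
          sum_subtractf diff_divide_distrib flip: sum_divide_distrib)
  qed (rule conv_operator_L2)
  have "0 \<le> Re (inner_L2 G f (f - ?R s f))" if "s \<in> K" for s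
  proof -
    have s: "s \<in> carrier G" using sym_class_closed(1)[OF K] that by blast
    have "Re (inner_L2 G (?R s f) f) = Re (inner_L2 G f (?R s f))"
      using arg_cong[OF cnj_inner[of f "?R s f"], of Re] by simp
    \<comment> \<open>Translation preserves the norm of \<open>f\<close>, so both squared norms in
      the expansion agree.\<close>
    then have "Re (inner_L2 G (f - ?R s f) (f - ?R s f)) = 2 * Re (inner_L2 G f (f - ?R s f))"
      by (simp add: inner_diff_left inner_diff_right inner_right_translation[OF s])
    then show ?thesis using inner_self_nonneg[of "f - ?R s f"] by simp
  qed
  then show ?thesis
    unfolding eq inner_sum_right inner_scale_right Re_sum by (intro sum_nonneg) simp
qed

text \<open>Lets \<open>class_laplacian\<close> be exchanged for a convolution operator, with which
  it agrees on \<open>L2 G\<close>.\<close>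

lemma eigenvalue_mean_cong:
  assumes "\<And>f. f \<in> A \<Longrightarrow> T f = S f"
  shows "eigenvalue_mean T A = eigenvalue_mean S A"
proof -
  have "eigenvalues_on T A = eigenvalues_on S A" using assms by (auto simp: eigenvalues_on_def)
  moreover have "eigenspace_on T A l = eigenspace_on S A l" for l
    using assms by (auto simp: eigenspace_on_def)
  ultimately show ?thesis by (simp add: eigenvalue_mean_def)
qed

lemma conv_operator_span:
  assumes "right_invariant (cfun.span B)" "f \<in> cfun.span B"
  shows "conv_operator G \<delta> f \<in> cfun.span B"
  unfolding conv_operator_eq_sum using assms
  by (intro cfun.span_sum cfun.span_scale) (simp add: right_invariant_def)

end

section \<open>Comparison of the averaged kernel with the Laplacian kernel\<close>

theorem proposition7:
  fixes G :: "('a, 'b) monoid_scheme" (structure)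
    and \<phi> :: "'a \<Rightarrow> complex"
    and \<alpha> :: "'a set \<Rightarrow> real"
  assumes "group G"
    and "finite (carrier G)"
    and "\<phi> \<in> L2 G"
    and "admissible G (conv_operator G \<phi>)"
    and "\<forall>\<sigma>\<in>dual G. omega G (conv_operator G \<phi>) \<sigma> =
           (\<Sum>K\<in>sym_classes G. of_real (\<alpha> K) * omega G (class_laplacian G K) \<sigma>)"
    and "\<forall>K\<in>sym_classes G. 0 \<le> \<alpha> K"
  shows "positive_semidefinite G (conv_operator G (conj_average G \<phi>)) \<and>
    (\<forall>f\<in>L2 G. conv_operator G (conj_average G \<phi>) f =
       graph_laplacian (cayley_graph G) (cayley_weight \<alpha>) f)"
proof -
  interpret finite_group G using assms(1,2) by (simp add: finite_group_def finite_group_axioms_def)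
  let ?\<psi> = "conj_average G \<phi>" and ?\<kappa> = "weighted_class_kernel \<alpha>"
  have herm: "hermitian_operator G (conv_operator G \<phi>)" using assms(4) by (simp add: admissible_def)
  \<comment> \<open>Hermiticity as a symmetry of the kernel passes to the conjugation
    average.\<close>
  note \<phi>_inv = hermitian_conv_kernel[OF herm]
  have \<kappa>_inv: "?\<kappa> (inv x) = cnj (?\<kappa> x)" if "x \<in> carrier G" for x
    using that by (simp add: weighted_class_kernel_def class_kernel_inv)
  have \<kappa>_conj: "?\<kappa> (a \<otimes> x \<otimes> inv a) = ?\<kappa> x" if "a \<in> carrier G" "x \<in> carrier G" for a x
    using that by (simp add: weighted_class_kernel_def class_kernel_conj)
  \<comment> \<open>The difference kernel inherits the Hermitian symmetry and is a class function,
    so only its traces have to be computed.\<close>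
  have "conv_operator G (\<lambda>x. ?\<psi> x - ?\<kappa> x) f = 0" if "f \<in> L2 G" for f
  proof (rule conv_operator_eq_zero[OF _ _ _ that])
    fix c B
    assume c: "c \<in> dual G" and B: "orthonormal G B" "right_invariant (cfun.span B)"
      "cfun.span B = matrix_coeff_space G (unitary_representative G c)" "B \<noteq> {}"
    have BL2: "cfun.span B \<subseteq> L2 G" unfolding B(3) by (rule matrix_coeff_space_L2)
    have mean: "eigenvalue_mean (conv_operator G \<delta>) (cfun.span B) =
        operator_trace G B (conv_operator G \<delta>) / of_nat (card B)"
      if "\<And>x. x \<in> carrier G \<Longrightarrow> \<delta> (inv x) = cnj (\<delta> x)" for \<delta>
    proof (rule eigenvalue_mean_eq_trace[OF _ B(1)])
      show "hermitian_operator G (conv_operator G \<delta>)" by (rule conv_operator_hermitian) (rule that)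
    qed (rule conv_operator_span[OF B(2)])
    have omega_\<phi>: "omega G (conv_operator G \<phi>) c = operator_trace G B (conv_operator G \<phi>) / of_nat (card B)"
      unfolding omega_def B(3)[symmetric] by (rule mean) (rule \<phi>_inv)
    have omega_K: "omega G (class_laplacian G K) c =
        operator_trace G B (conv_operator G (class_kernel K)) / of_nat (card B)"
      if K: "K \<in> sym_classes G" for K
    proof -
      have "omega G (class_laplacian G K) c = eigenvalue_mean (conv_operator G (class_kernel K)) (cfun.span B)"
        unfolding omega_def B(3)[symmetric]
        by (rule eigenvalue_mean_cong) (use class_laplacian_eq_conv[OF K] BL2 in blast)
      also have "\<dots> = operator_trace G B (conv_operator G (class_kernel K)) / of_nat (card B)"
        by (rule mean) (rule class_kernel_inv[OF K])
      finally show ?thesis .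
    qed
    \<comment> \<open>Division by zero yields 0, so traces can be recovered from means only once
      \<open>card B = 0\<close> is excluded.\<close>
    have "card B \<noteq> 0" using B(1,4) by (simp add: orthonormal_def)
    have "operator_trace G B (conv_operator G \<phi>) / of_nat (card B) =
        (\<Sum>K\<in>sym_classes G. of_real (\<alpha> K) * operator_trace G B (conv_operator G (class_kernel K))) /
          of_nat (card B)"
      using assms(5) c omega_\<phi> omega_K by (simp add: sum_divide_distrib)
    then have "operator_trace G B (conv_operator G \<phi>) =
        (\<Sum>K\<in>sym_classes G. of_real (\<alpha> K) * operator_trace G B (conv_operator G (class_kernel K)))"
      using \<open>card B \<noteq> 0\<close> by simp
    \<comment> \<open>Linearity of the trace collects the class Laplacians into the single kernel
      \<open>?\<kappa>\<close>.\<close>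
    also have "\<dots> = operator_trace G B (conv_operator G ?\<kappa>)"
      unfolding operator_trace_def conv_weighted_class_kernel inner_sum_right inner_scale_right
        sum_distrib_left
      by (rule sum.swap)
    finally have "operator_trace G B (conv_operator G \<phi>) = operator_trace G B (conv_operator G ?\<kappa>)" .
    moreover have "operator_trace G B (conv_operator G ?\<psi>) = operator_trace G B (conv_operator G \<phi>)"
      using trace_conj_average[OF B(1,2)] .
    ultimately show "operator_trace G B (conv_operator G (\<lambda>x. ?\<psi> x - ?\<kappa> x)) = 0"
      by (simp add: operator_trace_def conv_operator_diff inner_diff_right sum_subtractf)
  qed (simp_all add: conj_average_inv \<phi>_inv \<kappa>_inv conj_average_conj \<kappa>_conj)
  then have eq: "conv_operator G ?\<psi> f = conv_operator G ?\<kappa> f" if "f \<in> L2 G" for f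
    using that by (simp add: conv_operator_diff)
  \<comment> \<open>Here the sign of the weights enters: the form is a nonnegative combination of
    the Dirichlet forms of the classes.\<close>
  have "0 \<le> Re (inner_L2 G f (conv_operator G ?\<psi> f))" if f: "f \<in> L2 G" for f
    unfolding eq[OF f] conv_weighted_class_kernel inner_sum_right inner_scale_right Re_sum
    using assms(6) conv_class_kernel_nonneg[OF _ f] by (intro sum_nonneg) simp
  moreover have "hermitian_operator G (conv_operator G ?\<psi>)"
    by (rule conv_operator_hermitian) (simp add: conj_average_inv \<phi>_inv)
  ultimately show ?thesis
    using eq conv_weighted_class_kernel_eq_laplacian by (simp add: positive_semidefinite_def)
qed

end
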